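(* In the stratified type and effect system, if $R;\Gamma\vdash M:(B,e)$ then $R;\Gamma\models M:(B,e)$; that is, writing $\Gamma=x_1:A_1,\ldots,x_n:A_n$, for every $R'\ge R$ and all values $V_1,\ldots,V_n$ with $R'\vdash V_i\in[\![R\vdash(A_i,\emptyset)]\!]$ for $i=1,\ldots,n$, we have $R'\vdash[V_1/x_1,\ldots,V_n/x_n]M\in[\![R\vdash(B,e)]\!]$.
   Context: Syntax. Regions $r,s,\ldots$; effects $e$ are finite sets of regions. Types: $A ::= \mathbf{1} \mid \mathrm{Reg}_r A \mid A\xrightarrow{e}A$. Region contexts $R=r_1:A_1,\ldots,r_n:A_n$, $\mathrm{dom}(R)=\{r_1,\ldots,r_n\}$; contexts $\Gamma=x_1:A_1,\ldots,x_n:A_n$. Terms $M ::= x\mid r\mid *\mid \lambda x.M\mid MM\mid \mathsf{get}(M)\mid\mathsf{set}(M,M)$; values $V::= r\mid *\mid \lambda x.M$; $[V_1/x_1,\ldots]M$ is simultaneous substitution. A store is a finite collection of bindings $r\Leftarrow v$ with $v$ a set of values ($r\Leftarrow v_1,r\Leftarrow v_2$ identified with $r\Leftarrow v_1\cup v_2$, $r\Leftarrow V$ meaning $r\Leftarrow\{V\}$); $\mathrm{dom}(S)$ is the set of bound regions, $S(r)$ the set of values bound to $r$. Reduction. Evaluation contexts $E ::= [\,]\mid EM\mid VE\mid \mathsf{get}(E)\mid\mathsf{set}(E,M)\mid\mathsf{set}(V,E)$. Rules: $E[(\lambda x.M)V]\to E[[V/x]M]$; $E[\mathsf{get}(r)],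 r\Leftarrow V\to E[V], r\Leftarrow V$; $E[\mathsf{set}(r,V)]\to E[*], r\Leftarrow V$; if $P\to P'$ then $P,P''\to P',P''$. Stratified well-formedness: $\emptyset\vdash$; if $R\vdash A$, $r\notin\mathrm{dom}(R)$ then $R,r:A\vdash$; if $R\vdash$ then $R\vdash\mathbf 1$; if $R\vdash$, $r:A\in R$ then $R\vdash\mathrm{Reg}_rA$; if $R\vdash A$, $R\vdash B$, $e\subseteq\mathrm{dom}(R)$ then $R\vdash A\xrightarrow{e}B$; $R\vdash(A,e)$ iff $R\vdash A$ and $e\subseteq\mathrm{dom}(R)$; $R\vdash\Gamma$ iff $R\vdash$ and $R\vdash A_i$ for each $x_i:A_i\in\Gamma$. Subtyping: if $R\vdash A$ then $R\vdash A\le A$; if $R\vdash A'\le A$, $R\vdash B\le B'$, $e\subseteq e'\subseteq\mathrm{dom}(R)$ then $R\vdash (A\xrightarrow{e}B)\le(A'\xrightarrow{e'}B')$; if $R\vdash A\le A'$, $e\subseteq e'\subseteq\mathrm{dom}(R)$ then $R\vdash(A,e)\le(A',e')$. Typing: if $R\vdash\Gamma$, $x:A\in\Gamma$ then $R;\Gamma\vdash x:(A,\emptyset)$; if $R\vdash\Gamma$, $r:A\in R$ then $R;\Gamma\vdash r:(\mathrm{Reg}_rA,\emptyset)$; if $R\vdash\Gamma$ then $R;\Gamma\vdash *:(\mathbf 1,\emptyset)$; from $R;\Gamma,x:A\vdash M:(B,e)$ infer $R;\Gamma\vdash\lambda x.M:(A\xrightarrow{e}B,\emptyset)$; from $R;\Gamma\vdash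 M:(A\xrightarrow{e_2}B,e_1)$ and $R;\Gamma\vdash N:(A,e_3)$ infer $R;\Gamma\vdash MN:(B,e_1\cup e_2\cup e_3)$; from $R;\Gamma\vdash M:(\mathrm{Reg}_rA,e)$ infer $R;\Gamma\vdash\mathsf{get}(M):(A,e\cup\{r\})$; from $R;\Gamma\vdash M:(\mathrm{Reg}_rA,e_1)$ and $R;\Gamma\vdash N:(A,e_2)$ infer $R;\Gamma\vdash\mathsf{set}(M,N):(\mathbf 1,e_1\cup e_2\cup\{r\})$; from $R;\Gamma\vdash M:(A,e)$ and $R\vdash(A,e)\le(A',e')$ infer $R;\Gamma\vdash M:(A',e')$. Interpretation. $SN$ is the set of single-threaded programs $M,S$ all of whose reduction sequences are finite. $(M,S)\Downarrow(N,S')$ means $M,S\to^* N,S'$ and $N,S'$ is irreducible. $R'\ge R$ means $R'\vdash$ and $R'=R,R''$ for some $R''$. For $R=r_1:A_1,\ldots,r_n:A_n$ let $R_{r_i}=r_1:A_1,\ldots,r_{i-1}:A_{i-1}$. Define, by induction on the height of the derivations of $R\vdash$ and $R\vdash(A,e)$: $[\![R]\!]$ is the set of pairs $R'\vdash S$ with $R'\ge R$, $\mathrm{dom}(S)=\mathrm{dom}(R)$ and $S(r_i)=\{V\mid R'\vdash V\in[\![R_{r_i}\vdash(A_i,\emptyset)]\!]\}$ for each $i$; $[\![R]\!](R')$ denotes the unique such $S$. $[\![R\vdash(A,e)]\!]$ is the set of pairs $R'\vdash M$ such that (1) $R'\ge R$ and $R';\emptyset\vdash M:(A,e)$; (2)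 for all $R''\ge R'$, $M,[\![R]\!](R'')\in SN$; (3) for all $R''\ge R'$ and all $M',S'$, if $(M,[\![R]\!](R''))\Downarrow(M',S')$ then $S'=[\![R]\!](R'')$ and $\mathcal C(A,R,R'',M')$, where $\mathcal C(A,R,R'',M')$ means: if $A=\mathbf 1$ then $M'=*$; if $A=\mathrm{Reg}_rB$ then $M'=r$; if $A=A_1\xrightarrow{e'}A_2$ then $M'=\lambda x.N$ for some $N$ and for all $R_1\ge R''$ and all $V$, $R_1\vdash V\in[\![R\vdash(A_1,\emptyset)]\!]$ implies $R_1\vdash M'V\in[\![R\vdash(A_2,e')]\!]$. *)

theory Defs
  imports Main "HOL-Library.FSet" "HOL-Library.Finite_Map" "HOL-Library.Multiset"
begin

type_synonym region = nat
type_synonym eff = "region fset"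

datatype ty = TUnit | TReg region ty | TFun ty eff ty

(* Written left to right, so that R, r:A is R @ [(r, A)]. *)
type_synonym rctx = "(region \<times> ty) list"

(* De Bruijn contexts: entry 0 is the innermost variable, so that Gamma, x:A is A # Gamma. *)
type_synonym ctx = "ty list"

(* Terms modulo alpha-conversion, in de Bruijn form.  The values r, * and \<lambda>x. M have their own
   type and are embedded into terms by Val; a variable is not a value. *)
datatype trm =
    Var nat
  | Val val
  | App trm trm
  | Get trm
  | Set trm trm
and val =
    Loc region
  | Star
  | Lam trm


primrec lift_ren :: "(nat \<Rightarrow> nat) \<Rightarrow> nat \<Rightarrow> nat" where
  "lift_ren f 0 = 0"
| "lift_ren f (Suc n) = Suc (f n)"

primrec rename :: "trm \<Rightarrow> (nat \<Rightarrow> nat) \<Rightarrow> trm"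
    and rename_val :: "val \<Rightarrow> (nat \<Rightarrow> nat) \<Rightarrow> val" where
  "rename (Var n) f = Var (f n)"
| "rename (Val V) f = Val (rename_val V f)"
| "rename (App M N) f = App (rename M f) (rename N f)"
| "rename (Get M) f = Get (rename M f)"
| "rename (Set M N) f = Set (rename M f) (rename N f)"
| "rename_val (Loc r) f = Loc r"
| "rename_val Star f = Star"
| "rename_val (Lam M) f = Lam (rename M (lift_ren f))"

primrec lift_sub :: "(nat \<Rightarrow> trm) \<Rightarrow> nat \<Rightarrow> trm" where
  "lift_sub s 0 = Var 0"
| "lift_sub s (Suc n) = rename (s n) Suc"

primrec subst :: "trm \<Rightarrow> (nat \<Rightarrow> trm) \<Rightarrow> trm"
    and subst_val :: "val \<Rightarrow> (nat \<Rightarrow> trm) \<Rightarrow> val" where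
  "subst (Var n) s = s n"
| "subst (Val V) s = Val (subst_val V s)"
| "subst (App M N) s = App (subst M s) (subst N s)"
| "subst (Get M) s = Get (subst M s)"
| "subst (Set M N) s = Set (subst M s) (subst N s)"
| "subst_val (Loc r) s = Loc r"
| "subst_val Star s = Star"
| "subst_val (Lam M) s = Lam (subst M (lift_sub s))"

(* [V_1/x_1, ..., V_n/x_n]M, for the n innermost variables of M; the remaining indices move down. *)
definition msubst :: "val list \<Rightarrow> trm \<Rightarrow> trm" where
  "msubst Vs M =
     subst M (\<lambda>i. if i < length Vs then Val (Vs ! i) else Var (i - length Vs))"


datatype ectx =
    Hole
  | EAppL ectx trm
  | EAppR val ectx
  | EGet ectx
  | ESetL ectx trm
  | ESetR val ectx

primrec plug :: "ectx \<Rightarrow> trm \<Rightarrow> trm" where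
  "plug Hole M = M"
| "plug (EAppL E N) M = App (plug E M) N"
| "plug (EAppR V E) M = App (Val V) (plug E M)"
| "plug (EGet E) M = Get (plug E M)"
| "plug (ESetL E N) M = Set (plug E M) N"
| "plug (ESetR V E) M = Set (Val V) (plug E M)"

(* A region may be bound to an infinite (or empty) set of values. *)
type_synonym store = "(region, val set) fmap"

context includes fmap.lifting begin

lift_definition store_union :: "store \<Rightarrow> store \<Rightarrow> store"
  is "\<lambda>S T r. case (S r, T r) of
        (None, t) \<Rightarrow> t | (s, None) \<Rightarrow> s | (Some v, Some w) \<Rightarrow> Some (v \<union> w)"
proof -
  fix S T :: "region \<Rightarrow> val set option"
  let ?U = "\<lambda>r. case (S r, T r) of
        (None, t) \<Rightarrow> t | (s, None) \<Rightarrow> s | (Some v, Some w) \<Rightarrow> Some (v \<union> w)"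
  assume "finite (dom S)" "finite (dom T)"
  moreover have "dom ?U \<subseteq> dom S \<union> dom T"
    by (auto split: option.splits)
  ultimately show "finite (dom ?U)"
    by (meson finite_UnI finite_subset)
qed

end

definition single :: "region \<Rightarrow> val \<Rightarrow> store" where
  "single r V = fmupd r {V} fmempty"

(* The threads of a program together with its store; a single-threaded program M, S
   is ({#M#}, S). *)
type_synonym prog = "trm multiset \<times> store"

definition par :: "prog \<Rightarrow> prog \<Rightarrow> prog" where
  "par P Q = (fst P + fst Q, store_union (snd P) (snd Q))"

inductive step :: "prog \<Rightarrow> prog \<Rightarrow> bool" where
  step_beta: "step ({#plug E (App (Val (Lam M)) (Val V))#}, fmempty)
                   ({#plug E (msubst [V] M)#}, fmempty)"
| step_get: "step ({#plug E (Get (Val (Loc r)))#}, single r V)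
                  ({#plug E (Val V)#}, single r V)"
| step_set: "step ({#plug E (Set (Val (Loc r)) (Val V))#}, fmempty)
                  ({#plug E (Val Star)#}, single r V)"
| step_par: "step P P' \<Longrightarrow> step (par P Q) (par P' Q)"


definition rdom :: "rctx \<Rightarrow> region fset" where
  "rdom R = fset_of_list (map fst R)"

inductive wf_rctx :: "rctx \<Rightarrow> bool" and wf_ty :: "rctx \<Rightarrow> ty \<Rightarrow> bool" where
  wf_nil: "wf_rctx []"
| wf_snoc: "wf_ty R A \<Longrightarrow> r |\<notin>| rdom R \<Longrightarrow> wf_rctx (R @ [(r, A)])"
| wf_unit: "wf_rctx R \<Longrightarrow> wf_ty R TUnit"
| wf_reg: "wf_rctx R \<Longrightarrow> (r, A) \<in> set R \<Longrightarrow> wf_ty R (TReg r A)"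
| wf_fun: "wf_ty R A \<Longrightarrow> wf_ty R B \<Longrightarrow> e |\<subseteq>| rdom R \<Longrightarrow> wf_ty R (TFun A e B)"

definition wf_ctx :: "rctx \<Rightarrow> ctx \<Rightarrow> bool" where
  "wf_ctx R \<Gamma> \<longleftrightarrow> wf_rctx R \<and> (\<forall>A \<in> set \<Gamma>. wf_ty R A)"

inductive subty :: "rctx \<Rightarrow> ty \<Rightarrow> ty \<Rightarrow> bool" for R where
  subty_refl: "wf_ty R A \<Longrightarrow> subty R A A"
| subty_fun: "subty R A' A \<Longrightarrow> subty R B B' \<Longrightarrow> e |\<subseteq>| e' \<Longrightarrow> e' |\<subseteq>| rdom R \<Longrightarrow>
    subty R (TFun A e B) (TFun A' e' B')"

definition subty_eff :: "rctx \<Rightarrow> ty \<times> eff \<Rightarrow> ty \<times> eff \<Rightarrow> bool" where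
  "subty_eff R X Y \<longleftrightarrow> subty R (fst X) (fst Y) \<and> snd X |\<subseteq>| snd Y \<and> snd Y |\<subseteq>| rdom R"

inductive typing :: "rctx \<Rightarrow> ctx \<Rightarrow> trm \<Rightarrow> ty \<times> eff \<Rightarrow> bool" for R where
  ty_var: "wf_ctx R \<Gamma> \<Longrightarrow> i < length \<Gamma> \<Longrightarrow> \<Gamma> ! i = A \<Longrightarrow> typing R \<Gamma> (Var i) (A, {||})"
| ty_loc: "wf_ctx R \<Gamma> \<Longrightarrow> (r, A) \<in> set R \<Longrightarrow> typing R \<Gamma> (Val (Loc r)) (TReg r A, {||})"
| ty_star: "wf_ctx R \<Gamma> \<Longrightarrow> typing R \<Gamma> (Val Star) (TUnit, {||})"
| ty_lam: "typing R (A # \<Gamma>) M (B, e) \<Longrightarrow> typing R \<Gamma> (Val (Lam M)) (TFun A e B, {||})"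
| ty_app: "typing R \<Gamma> M (TFun A e2 B, e1) \<Longrightarrow> typing R \<Gamma> N (A, e3) \<Longrightarrow>
    typing R \<Gamma> (App M N) (B, e1 |\<union>| e2 |\<union>| e3)"
| ty_get: "typing R \<Gamma> M (TReg r A, e) \<Longrightarrow> typing R \<Gamma> (Get M) (A, e |\<union>| {|r|})"
| ty_set: "typing R \<Gamma> M (TReg r A, e1) \<Longrightarrow> typing R \<Gamma> N (A, e2) \<Longrightarrow>
    typing R \<Gamma> (Set M N) (TUnit, e1 |\<union>| e2 |\<union>| {|r|})"
| ty_sub: "typing R \<Gamma> M (A, e) \<Longrightarrow> subty_eff R (A, e) (A', e') \<Longrightarrow> typing R \<Gamma> M (A', e')"


definition SN :: "(trm \<times> store) set" where
  "SN = {(M, S). \<not> (\<exists>f :: nat \<Rightarrow> prog. f 0 = ({#M#}, S) \<and> (\<forall>i. step (f i) (f (Suc i))))}"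

definition eval_to :: "trm \<times> store \<Rightarrow> trm \<times> store \<Rightarrow> bool" where
  "eval_to X Y \<longleftrightarrow> step\<^sup>*\<^sup>* ({#fst X#}, snd X) ({#fst Y#}, snd Y) \<and>
     \<not> (\<exists>P. step ({#fst Y#}, snd Y) P)"

definition rext :: "rctx \<Rightarrow> rctx \<Rightarrow> bool" where
  "rext R' R \<longleftrightarrow> wf_rctx R' \<and> (\<exists>R''. R' = R @ R'')"

(* The interpretations of R and of R |- (A, e); den_store R R' is the store assigned to R' by the
   former.  Instead of the height of derivations, the recursion descends along the length of R and
   then the size of A, which also makes the functions total; outside well-formed arguments their
   values are meaningless. *)
function (sequential)
      den_rctx :: "rctx \<Rightarrow> (rctx \<times> store) set"
  and den_store :: "rctx \<Rightarrow> rctx \<Rightarrow> store"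
  and den_ty :: "rctx \<Rightarrow> ty \<Rightarrow> eff \<Rightarrow> (rctx \<times> trm) set" where
  "den_rctx R =
     {(R', S). rext R' R \<and> fmdom S = rdom R \<and>
        (\<forall>i < length R. fmlookup S (fst (R ! i)) =
           Some {V. (R', Val V) \<in> den_ty (take i R) (snd (R ! i)) {||}})}"
| "den_store R R' = (THE S. (R', S) \<in> den_rctx R)"
| "den_ty R A e =
     {(R', M). rext R' R \<and> typing R' [] M (A, e) \<and>
        (\<forall>R''. rext R'' R' \<longrightarrow> (M, den_store R R'') \<in> SN) \<and>
        (\<forall>R''. rext R'' R' \<longrightarrow>
          (\<forall>M' S'. eval_to (M, den_store R R'') (M', S') \<longrightarrow>
             S' = den_store R R'' \<and>
             (case A of
                TUnit \<Rightarrow> M' = Val Star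
              | TReg r B \<Rightarrow> M' = Val (Loc r)
              | TFun A1 e' A2 \<Rightarrow>
                  (\<exists>N. M' = Val (Lam N)) \<and>
                  (\<forall>R1 V. rext R1 R'' \<longrightarrow> (R1, Val V) \<in> den_ty R A1 {||} \<longrightarrow>
                     (R1, App M' (Val V)) \<in> den_ty R A2 e'))))}"
  by pat_completeness auto
termination
  by (relation "inv_image (less_than <*lex*> less_than)
        (\<lambda>x. case x of
            Inl R \<Rightarrow> (length R, 0)
          | Inr (Inl (R, R')) \<Rightarrow> (length R, 1)
          | Inr (Inr (R, A, e)) \<Rightarrow> (length R, 2 + size A))")
     auto

declare den_rctx.simps [simp del] den_store.simps [simp del] den_ty.simps [simp del]

definition sem_typing :: "rctx \<Rightarrow> ctx \<Rightarrow> trm \<Rightarrow> ty \<times> eff \<Rightarrow> bool" where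
  "sem_typing R \<Gamma> M X \<longleftrightarrow>
     (\<forall>R' Vs. rext R' R \<longrightarrow> length Vs = length \<Gamma> \<longrightarrow>
        (\<forall>i < length \<Gamma>. (R', Val (Vs ! i)) \<in> den_ty R (\<Gamma> ! i) {||}) \<longrightarrow>
        (R', msubst Vs M) \<in> den_ty R (fst X) (snd X))"

end

(* Single-threaded convergence is phrased at a fixed store: every reduction from M at the store
   [[R]](R') leaves that store unchanged and ends in a good value.  The store already contains every
   value that a well-typed write can add and a value for every possible read, so the theorem follows
   by induction on typing, with one compatibility property per rule.  The delicate point is that the
   values stored in r_i are interpreted at the prefix R_{r_i} but read at R: the two interpretations
   agree because, by subject reduction, a term only touches the regions of its effect, where the
   stores for a context and for its extensions coincide. *)

theory Submission imports Defs begin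

text \<open>Convergence is an inductive predicate because a read may choose from an infinite set. A
  term can have infinitely many reducts, so induction follows the reduction relation and not the
  length of a longest sequence. The outcome clauses of the interpretation record the shape and the
  applicative behaviour of a value but not its type, whereas an argument or a written value must be
  typed to belong to the interpretation. Subject reduction supplies that type, which is why it is
  needed besides the comparison of stores. A function built at one context may be called at a later
  one, whose store may hold more values. The clauses quantify over all extensions for this reason,
  and every interpretation is therefore closed under extension.\<close>

section \<open>Substitution\<close>

lemma lift_ren_comp: "lift_ren g (lift_ren f i) = lift_ren (\<lambda>i. g (f i)) i"
  by (cases i) auto

lemma rename_rename:
  "rename (rename M f) g = rename M (\<lambda>i. g (f i))"
  "rename_val (rename_val V f) g = rename_val V (\<lambda>i. g (f i))"
proof (induction M and V arbitrary: f g and f g)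
  case (Lam M)
  have "(\<lambda>i. lift_ren g (lift_ren f i)) = lift_ren (\<lambda>i. g (f i))"
    by (simp add: fun_eq_iff lift_ren_comp)
  then show ?case by (simp add: Lam)
qed auto

lemma subst_rename:
  "subst (rename M f) s = subst M (\<lambda>i. s (f i))"
  "subst_val (rename_val V f) s = subst_val V (\<lambda>i. s (f i))"
proof (induction M and V arbitrary: f s and f s)
  case (Lam M)
  have "lift_sub s (lift_ren f i) = lift_sub (\<lambda>i. s (f i)) i" for i
    by (cases i) auto
  then have "(\<lambda>i. lift_sub s (lift_ren f i)) = lift_sub (\<lambda>i. s (f i))"
    by (simp add: fun_eq_iff)
  then show ?case by (simp add: Lam)
qed auto

lemma rename_subst:
  "rename (subst M s) f = subst M (\<lambda>i. rename (s i) f)"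
  "rename_val (subst_val V s) f = subst_val V (\<lambda>i. rename (s i) f)"
proof (induction M and V arbitrary: f s and f s)
  case (Lam M)
  have "rename (lift_sub s i) (lift_ren f) = lift_sub (\<lambda>i. rename (s i) f) i" for i
    by (cases i) (auto simp: rename_rename)
  then have "(\<lambda>i. rename (lift_sub s i) (lift_ren f)) = lift_sub (\<lambda>i. rename (s i) f)"
    by (simp add: fun_eq_iff)
  then show ?case by (simp add: Lam)
qed auto

text \<open>Under a binder the two lifted substitutions are compared index by index. At a successor
  index both sides shift by \<open>Suc\<close>, once before and once after a substitution, so the
  two mixed laws have to come first.\<close>

lemma subst_subst:
  "subst (subst M s) t = subst M (\<lambda>i. subst (s i) t)"
  "subst_val (subst_val V s) t = subst_val V (\<lambda>i. subst (s i) t)"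
proof (induction M and V arbitrary: s t and s t)
  case (Lam M)
  have "subst (lift_sub s i) (lift_sub t) = lift_sub (\<lambda>i. subst (s i) t) i" for i
    by (cases i) (auto simp: rename_subst subst_rename)
  then have "(\<lambda>i. subst (lift_sub s i) (lift_sub t)) = lift_sub (\<lambda>i. subst (s i) t)"
    by (simp add: fun_eq_iff)
  then show ?case by (simp add: Lam)
qed auto

lemma lift_sub_Var: "lift_sub Var = Var"
proof
  show "lift_sub Var i = Var i" for i by (cases i) auto
qed

lemma subst_Var: "subst M Var = M" "subst_val V Var = V"
  by (induction M and V) (auto simp: lift_sub_Var)

definition value_sub :: "val list \<Rightarrow> nat \<Rightarrow> trm" where
  "value_sub Vs i = (if i < length Vs then Val (Vs ! i) else Var (i - length Vs))"

lemma msubst_eq: "msubst Vs M = subst M (value_sub Vs)"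
  by (simp add: msubst_def value_sub_def[abs_def])

text \<open>Beta reduction of an abstraction already instantiated by \<open>Vs\<close> yields its
  body instantiated by \<open>V # Vs\<close>, which is the form that the induction hypothesis for
  abstraction speaks of.\<close>

lemma msubst_Cons: "msubst [V] (subst M (lift_sub (value_sub Vs))) = msubst (V # Vs) M"
proof -
  have "subst (lift_sub (value_sub Vs) i) (value_sub [V]) = value_sub (V # Vs) i" for i
  proof (cases i)
    case 0
    then show ?thesis by (simp add: value_sub_def)
  next
    case (Suc j)
    \<comment> \<open>The substitution for index 0 lowers all other indices and so undoes the shift
      made by \<open>lift_sub\<close>. The values in \<open>Vs\<close> come back unchanged whether
      or not they are closed.\<close>
    have "(\<lambda>i. value_sub [V] (Suc i)) = Var"
      by (simp add: fun_eq_iff value_sub_def)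
    then show ?thesis using Suc
      by (simp add: subst_rename subst_Var) (simp add: value_sub_def)
  qed
  then show ?thesis by (simp add: msubst_eq subst_subst)
qed

section \<open>Stores and single-threaded reduction\<close>

lemma fmlookup_store_union:
  "fmlookup (store_union S T) r = (case (fmlookup S r, fmlookup T r) of
     (None, t) \<Rightarrow> t | (s, None) \<Rightarrow> s | (Some v, Some w) \<Rightarrow> Some (v \<union> w))"
  by (simp add: store_union.rep_eq)

lemma fmlookup_single: "fmlookup (single r V) q = (if q = r then Some {V} else None)"
  by (simp add: single_def)

lemma store_union_assoc: "store_union (store_union S T) U = store_union S (store_union T U)"
  by (rule fmap_ext) (auto simp: fmlookup_store_union split: option.splits)

lemma store_union_comm: "store_union S T = store_union T S"
  by (rule fmap_ext) (auto simp: fmlookup_store_union split: option.splits)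

lemma store_union_idem: "store_union S S = S"
  by (rule fmap_ext) (auto simp: fmlookup_store_union split: option.splits)

lemma store_union_empty: "store_union fmempty S = S"
  by (rule fmap_ext) (auto simp: fmlookup_store_union split: option.splits)

text \<open>Absorption of a singleton is common to both store operations: it holds exactly when a
  read at \<open>r\<close> may return \<open>V\<close>, and exactly when writing \<open>V\<close> to
  \<open>r\<close> changes nothing.\<close>

lemma store_union_single_absorb:
  "store_union (single r V) S = S \<longleftrightarrow> (\<exists>vs. fmlookup S r = Some vs \<and> V \<in> vs)"
proof
  assume "store_union (single r V) S = S"
  then have "fmlookup (store_union (single r V) S) r = fmlookup S r" by simp
  then show "\<exists>vs. fmlookup S r = Some vs \<and> V \<in> vs"
    by (auto simp: fmlookup_store_union fmlookup_single split: option.splits)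
next
  assume "\<exists>vs. fmlookup S r = Some vs \<and> V \<in> vs"
  then show "store_union (single r V) S = S"
    by (intro fmap_ext) (auto simp: fmlookup_store_union fmlookup_single split: option.splits)
qed

text \<open>One thread with its whole ambient store, so that parallel composition no longer appears
  as a rule. Store union is idempotent, so the binding consulted by a read need not be split off; it
  is enough that \<open>S\<close> absorbs it.\<close>

inductive head_red :: "trm \<Rightarrow> store \<Rightarrow> trm \<Rightarrow> store \<Rightarrow> bool" where
  head_beta: "head_red (App (Val (Lam M)) (Val V)) S (msubst [V] M) S"
| head_get: "store_union (single r V) S = S \<Longrightarrow> head_red (Get (Val (Loc r))) S (Val V) S"
| head_set: "head_red (Set (Val (Loc r)) (Val V)) S (Val Star) (store_union (single r V) S)"

inductive red :: "trm \<Rightarrow> store \<Rightarrow> trm \<Rightarrow> store \<Rightarrow> bool" where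
  red_plug: "head_red M S M' S' \<Longrightarrow> red (plug E M) S (plug E M') S'"

lemma red_step:
  assumes "red M S M' S'"
  shows "step ({#M#}, S) ({#M'#}, S')"
  using assms
proof cases
  case (red_plug h h' E)
  from red_plug(3) show ?thesis
  proof cases
    case (head_beta N V)
    show ?thesis
      \<comment> \<open>In all three cases the frame has no thread and carries the whole store. For
        a read the binding is then present twice, and the two copies merge.\<close>
      using step_par[OF step_beta[of E N V], of "({#}, S)"]
      by (simp add: red_plug head_beta par_def store_union_empty)
  next
    case (head_get r V)
    show ?thesis
      using step_par[OF step_get[of E r V], of "({#}, S)"] head_get
      by (simp add: red_plug par_def)
  next
    case (head_set r V)
    show ?thesis
      using step_par[OF step_set[of E r V], of "({#}, S)"] head_set
      by (simp add: red_plug par_def store_union_empty)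
  qed
qed

lemma head_red_store_union:
  "head_red M S M' S' \<Longrightarrow> head_red M (store_union S T) M' (store_union S' T)"
proof (induction rule: head_red.induct)
  case (head_get r V S)
  then show ?case by (intro head_red.head_get) (simp flip: store_union_assoc)
qed (simp_all add: store_union_assoc head_red.intros)

lemma red_store_union: "red M S M' S' \<Longrightarrow> red M (store_union S T) M' (store_union S' T)"
  by (induction rule: red.induct) (auto intro: red.intros head_red_store_union)

text \<open>In a parallel composition with a single thread in total, this makes the active component
  own the thread and leaves only a store to the other one.\<close>

lemma step_nonempty: "step P P' \<Longrightarrow> fst P \<noteq> {#}"
  by (induction rule: step.induct) (auto simp: par_def)

lemma step_red:
  "step P P' \<Longrightarrow> fst P = {#M#} \<Longrightarrow> \<exists>M'. fst P' = {#M'#} \<and> red M (snd P) M' (snd P')"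
proof (induction rule: step.induct)
  case (step_beta E N V)
  then show ?case by (auto intro: red.intros head_red.intros)
next
  case (step_get E r V)
  then show ?case by (auto intro!: red.intros head_red.intros simp: store_union_idem)
next
  case (step_set E r V)
  have "head_red (Set (Val (Loc r)) (Val V)) fmempty (Val Star) (single r V)"
    using head_set[of r V fmempty] store_union_comm[of "single r V" fmempty]
    by (simp only: store_union_empty)
  with step_set show ?case by (auto intro: red.intros)
next
  case (step_par P P' Q)
  have "fst P = {#M#}" "fst Q = {#}"
    using step_par.prems step_nonempty[OF step_par.hyps]
    by (auto simp: par_def union_is_single)
  with step_par.IH show ?case
    by (auto simp: par_def intro: red_store_union)
qed

lemma step_single_iff:
  "step ({#M#}, S) P \<longleftrightarrow> (\<exists>M' S'. P = ({#M'#}, S') \<and> red M S M' S')"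
  using step_red[of "({#M#}, S)" P M] red_step by (cases P) auto

text \<open>The equation expresses the pointwise inclusion order on stores: a write adds a value and
  no rule removes one.\<close>

lemma red_store_mono: "red M S M' S' \<Longrightarrow> store_union S S' = S'"
proof (induction rule: red.induct)
  case (red_plug M S M' S' E)
  then show ?case
  proof cases
    case (head_set r V)
    then show ?thesis by (metis store_union_assoc store_union_comm store_union_idem)
  qed (simp_all add: store_union_idem)
qed

section \<open>Composition of evaluation contexts and location of the redex\<close>

primrec ectx_comp :: "ectx \<Rightarrow> ectx \<Rightarrow> ectx" where
  "ectx_comp Hole E = E"
| "ectx_comp (EAppL F N) E = EAppL (ectx_comp F E) N"
| "ectx_comp (EAppR V F) E = EAppR V (ectx_comp F E)"
| "ectx_comp (EGet F) E = EGet (ectx_comp F E)"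
| "ectx_comp (ESetL F N) E = ESetL (ectx_comp F E) N"
| "ectx_comp (ESetR V F) E = ESetR V (ectx_comp F E)"

lemma plug_ectx_comp: "plug (ectx_comp F E) M = plug F (plug E M)"
  by (induction F) auto

lemma plug_eq_Val:
  "plug E M = Val V \<longleftrightarrow> E = Hole \<and> M = Val V"
  "Val V = plug E M \<longleftrightarrow> E = Hole \<and> M = Val V"
  by (cases E; auto)+

lemma head_red_not_Val: "head_red M S M' S' \<Longrightarrow> M \<noteq> Val V"
  by (auto elim: head_red.cases)

lemma red_not_Val: "\<not> red (Val V) S M' S'"
proof
  assume "red (Val V) S M' S'"
  then show False
  proof cases
    case (red_plug h h' E)
    then show False using head_red_not_Val[of h] by (metis plug_eq_Val)
  qed
qed

lemma red_in_context: "red M S M' S' \<Longrightarrow> red (plug F M) S (plug F M') S'"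
  by (metis red.simps plug_ectx_comp)

text \<open>The redex lies inside \<open>M\<close>. The contexts cannot part ways earlier: the
  evaluated components of a redex are values, which \<open>plug F M\<close> is not, and anything to
  the left of the hole of \<open>F\<close> is a value and contains no redex in evaluation
  position.\<close>

lemma head_red_plug_split:
  assumes "head_red h S h' S'" "plug F M = plug E h" "\<forall>V. M \<noteq> Val V"
  shows "\<exists>E'. E = ectx_comp F E' \<and> M = plug E' h"
  using assms(2)
proof (induction F arbitrary: E)
  case Hole
  then show ?case by auto
next
  case (EAppL F N)
  show ?case
  proof (cases E)
    case Hole
    then show ?thesis using EAppL.prems assms by (auto elim!: head_red.cases simp: plug_eq_Val)
  qed (use EAppL assms in \<open>auto simp: plug_eq_Val\<close>)
next
  case (EAppR V F)
  show ?case
  proof (cases E)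
    case Hole
    then show ?thesis using EAppR.prems assms by (auto elim!: head_red.cases simp: plug_eq_Val)
  next
    case (EAppL E' N)
    then have "plug E' h = Val V" using EAppR.prems by simp
    then show ?thesis using head_red_not_Val[OF assms(1)] by (auto simp: plug_eq_Val)
  qed (use EAppR assms in \<open>auto simp: plug_eq_Val\<close>)
next
  case (EGet F)
  show ?case
  proof (cases E)
    case Hole
    then show ?thesis using EGet.prems assms by (auto elim!: head_red.cases simp: plug_eq_Val)
  qed (use EGet assms in \<open>auto simp: plug_eq_Val\<close>)
next
  case (ESetL F N)
  show ?case
  proof (cases E)
    case Hole
    then show ?thesis using ESetL.prems assms by (auto elim!: head_red.cases simp: plug_eq_Val)
  qed (use ESetL assms in \<open>auto simp: plug_eq_Val\<close>)
next
  case (ESetR V F)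
  show ?case
  proof (cases E)
    case Hole
    then show ?thesis using ESetR.prems assms by (auto elim!: head_red.cases simp: plug_eq_Val)
  next
    case (ESetL E' N)
    then have "plug E' h = Val V" using ESetR.prems by simp
    then show ?thesis using head_red_not_Val[OF assms(1)] by (auto simp: plug_eq_Val)
  qed (use ESetR assms in \<open>auto simp: plug_eq_Val\<close>)
qed

lemma red_plugE:
  assumes "red (plug F M) S N S'" "\<forall>V. M \<noteq> Val V"
  obtains M' where "red M S M' S'" "N = plug F M'"
  using assms(1)
proof cases
  case (red_plug h h' E)
  with head_red_plug_split assms(2) obtain E' where "E = ectx_comp F E'" "M = plug E' h"
    by blast
  with red_plug that show ?thesis by (auto simp: plug_ectx_comp intro: red.intros)
qed

text \<open>The second assumption says that every evaluation position below the root holds a value,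
  so only the root can reduce.\<close>

lemma red_redex:
  assumes "red M S M' S'" and "\<And>E h. M = plug E h \<Longrightarrow> \<forall>V. h \<noteq> Val V \<Longrightarrow> E = Hole"
  shows "head_red M S M' S'"
  using assms(1)
proof cases
  case (red_plug h h' E)
  with assms(2) head_red_not_Val[of h] have "E = Hole" by blast
  with red_plug show ?thesis by simp
qed

lemma red_App_Val:
  assumes "red (App (Val V) (Val W)) S M' S'" shows "head_red (App (Val V) (Val W)) S M' S'"
  using assms
proof (rule red_redex)
  show "E = Hole" if "App (Val V) (Val W) = plug E h" "\<forall>V. h \<noteq> Val V" for E h
    using that by (cases E) (auto simp: plug_eq_Val)
qed

lemma red_Get_Val:
  assumes "red (Get (Val V)) S M' S'" shows "head_red (Get (Val V)) S M' S'"
  using assms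
proof (rule red_redex)
  show "E = Hole" if "Get (Val V) = plug E h" "\<forall>V. h \<noteq> Val V" for E h
    using that by (cases E) (auto simp: plug_eq_Val)
qed

lemma red_Set_Val:
  assumes "red (Set (Val V) (Val W)) S M' S'" shows "head_red (Set (Val V) (Val W)) S M' S'"
  using assms
proof (rule red_redex)
  show "E = Hole" if "Set (Val V) (Val W) = plug E h" "\<forall>V. h \<noteq> Val V" for E h
    using that by (cases E) (auto simp: plug_eq_Val)
qed

section \<open>Convergence at a fixed store\<close>

text \<open>The store is a parameter and not an index because every step is required to preserve it.
  Termination is implicit in the predicate being inductive.\<close>

inductive converges :: "store \<Rightarrow> (trm \<Rightarrow> bool) \<Rightarrow> trm \<Rightarrow> bool" for S P where
  convergesI: "(\<And>M' S'. red M S M' S' \<Longrightarrow> S' = S \<and> converges S P M') \<Longrightarrow>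
    ((\<And>M' S'. \<not> red M S M' S') \<Longrightarrow> P M) \<Longrightarrow> converges S P M"

lemma converges_Val: "converges S P (Val V) \<longleftrightarrow> P (Val V)"
  by (auto intro: convergesI elim: converges.cases simp: red_not_Val)

lemma converges_mono:
  "converges S P M \<Longrightarrow> (\<And>N. P N \<Longrightarrow> Q N) \<Longrightarrow> converges S Q M"
  by (induction rule: converges.induct) (blast intro: convergesI)

text \<open>Sequencing: the hole is evaluated first and its outcome is handed to the rest of the
  computation. \<open>P\<close> must entail being a value, since a stuck non-value in the hole would
  block the context.\<close>

lemma converges_plug:
  assumes "converges S P M" and "\<And>N. P N \<Longrightarrow> \<exists>V. N = Val V"
    and "\<And>V. P (Val V) \<Longrightarrow> converges S Q (plug F (Val V))"
  shows "converges S Q (plug F M)"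
  using assms(1)
proof (induction rule: converges.induct)
  case (convergesI M)
  show ?case
  proof (cases "\<exists>V. M = Val V")
    case True
    then show ?thesis using convergesI assms(3) red_not_Val by blast
  next
    case False
    \<comment> \<open>A non-value that converges cannot be stuck, so the plugged term is reducible
      as well and the clause for irreducible terms is vacuous.\<close>
    then obtain M0 S0 where "red M S M0 S0" using convergesI assms(2) by blast
    then have "red (plug F M) S (plug F M0) S0" by (rule red_in_context)
    with False show ?thesis
      by (intro converges.convergesI) (auto elim!: red_plugE dest: convergesI.IH)
  qed
qed

text \<open>Dependent choice bridges the two notions of termination: \<open>SN\<close> forbids
  infinite sequences, while the proofs need an induction principle.\<close>

lemma not_accp_chain:
  assumes "\<not> Wellfounded.accp r x"
  shows "\<exists>f. f 0 = x \<and> (\<forall>i. r (f (Suc i)) (f i))"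
proof -
  define next_of where "next_of y = (SOME z. \<not> Wellfounded.accp r z \<and> r z y)" for y
  have next_of: "\<not> Wellfounded.accp r (next_of y) \<and> r (next_of y) y"
    if "\<not> Wellfounded.accp r y" for y
    unfolding next_of_def by (rule someI_ex) (rule not_accp_down[OF that], blast)
  define f where "f = rec_nat x (\<lambda>_. next_of)"
  have "\<not> Wellfounded.accp r (f n)" for n
    by (induction n) (use assms next_of in \<open>auto simp: f_def\<close>)
  then have "f 0 = x \<and> (\<forall>i. r (f (Suc i)) (f i))"
    using next_of by (simp add: f_def)
  then show ?thesis by (rule exI[of _ f])
qed

lemma SN_accp: "(M, S) \<in> SN \<Longrightarrow> Wellfounded.accp (\<lambda>X Y. step Y X) ({#M#}, S)"
  unfolding SN_def using not_accp_chain[of "\<lambda>X Y. step Y X"] by blast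

lemma eval_to_iff:
  "eval_to (M, S) (M', S') \<longleftrightarrow>
    step\<^sup>*\<^sup>* ({#M#}, S) ({#M'#}, S') \<and> (\<forall>N T. \<not> red M' S' N T)"
  by (auto simp: eval_to_def step_single_iff)

text \<open>Clause (3) of the interpretation says something only about results, so to bound an
  intermediate store from above at least one result beyond it must exist.\<close>

lemma accp_eval_to:
  assumes "Wellfounded.accp (\<lambda>X Y. step Y X) P" "P = ({#M#}, S)"
  shows "\<exists>N T. eval_to (M, S) (N, T) \<and> store_union S T = T"
  using assms
proof (induction arbitrary: M S rule: accp.induct)
  case (accI P)
  show ?case
  proof (cases "\<exists>M' S'. red M S M' S'")
    case True
    then obtain M' S' where r: "red M S M' S'" by blast
    then obtain N T where "eval_to (M', S') (N, T)" "store_union S' T = T"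
      using accI.IH accI.prems red_step by blast
    moreover have "store_union S T = T"
      using calculation red_store_mono[OF r] by (metis store_union_assoc)
    ultimately show ?thesis
      using red_step[OF r] by (auto simp: eval_to_iff intro: converse_rtranclp_into_rtranclp)
  next
    case False
    then have "eval_to (M, S) (M, S)" by (auto simp: eval_to_iff)
    then show ?thesis using store_union_idem by blast
  qed
qed

text \<open>Stores only grow, so a terminating program whose final stores all equal the initial store
  never changes its store on the way.\<close>

lemma converges_iff:
  "converges S P M \<longleftrightarrow>
    (M, S) \<in> SN \<and> (\<forall>M' S'. eval_to (M, S) (M', S') \<longrightarrow> S' = S \<and> P M')"
proof
  assume "converges S P M"
  then show "(M, S) \<in> SN \<and> (\<forall>M' S'. eval_to (M, S) (M', S') \<longrightarrow> S' = S \<and> P M')"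
  proof (induction rule: converges.induct)
    case (convergesI M)
    have "(M, S) \<in> SN"
    proof (rule ccontr)
      assume "(M, S) \<notin> SN"
      then obtain f where f: "f 0 = ({#M#}, S)" "\<And>i. step (f i) (f (Suc i))"
        by (auto simp: SN_def)
      obtain M' S' where "f (Suc 0) = ({#M'#}, S')" "red M S M' S'"
        using f(1) f(2)[of 0] by (auto simp: step_single_iff)
      moreover have "S' = S" "(M', S) \<in> SN" using convergesI.IH calculation by auto
      ultimately have "\<nexists>g. g 0 = f (Suc 0) \<and> (\<forall>i. step (g i) (g (Suc i)))"
        by (simp add: SN_def)
      from this[unfolded not_ex, rule_format, of "\<lambda>i. f (Suc i)"] show False
        using f(2) by simp
    qed
    moreover have "S' = S \<and> P M'" if "eval_to (M, S) (M', S')" for M' S'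
    proof -
      from that have "step\<^sup>*\<^sup>* ({#M#}, S) ({#M'#}, S')" and nf: "\<forall>N T. \<not> red M' S' N T"
        by (auto simp: eval_to_iff)
      then show ?thesis
      proof (cases rule: converse_rtranclpE)
        case base
        then show ?thesis using convergesI.hyps nf by simp
      next
        case (step Y)
        then obtain N T where "Y = ({#N#}, T)" "red M S N T" by (auto simp: step_single_iff)
        with step nf convergesI.IH[of N T] show ?thesis by (auto simp: eval_to_iff)
      qed
    qed
    ultimately show ?case by blast
  qed
next
  assume *: "(M, S) \<in> SN \<and> (\<forall>M' S'. eval_to (M, S) (M', S') \<longrightarrow> S' = S \<and> P M')"
  have "converges S P M"
    if "Wellfounded.accp (\<lambda>X Y. step Y X) Y" "Y = ({#M#}, S)"
      "\<forall>M' S'. eval_to (M, S) (M', S') \<longrightarrow> S' = S \<and> P M'" for Y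
    using that
  proof (induction arbitrary: M rule: accp.induct)
    case (accI Y)
    show ?case
    proof (rule convergesI)
      fix M' S'
      assume r: "red M S M' S'"
      then have st: "step Y ({#M'#}, S')" using red_step accI.prems by simp
      have ev: "eval_to (M, S) (N, T)" if "eval_to (M', S') (N, T)" for N T
        using that red_step[OF r] by (auto simp: eval_to_iff intro: converse_rtranclp_into_rtranclp)
      \<comment> \<open>A result of the reduct is also a result of \<open>M\<close>, so its store
        \<open>T\<close> is \<open>S\<close>. Thus \<open>S'\<close> is below \<open>S\<close>, and
        monotonicity of the step gives the other inclusion.\<close>
      obtain N T where "eval_to (M', S') (N, T)" "store_union S' T = T"
        using accp_eval_to[OF accI.hyps[OF st]] by blast
      with ev accI.prems have "store_union S' S = S" by blast
      then have "S' = S" using red_store_mono[OF r] by (metis store_union_comm)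
      with ev accI.IH[OF st] accI.prems show "S' = S \<and> converges S P M'" by blast
    next
      assume "\<And>M' S'. \<not> red M S M' S'"
      then show "P M" using accI.prems by (auto simp: eval_to_iff)
    qed
  qed
  with * SN_accp show "converges S P M" by blast
qed

section \<open>Well-formedness and subtyping\<close>

lemma rdom_append [simp]: "rdom (R @ R') = rdom R |\<union>| rdom R'"
  by (simp add: rdom_def fset_of_list_append)

lemma rdom_Cons [simp]: "rdom (p # R) = finsert (fst p) (rdom R)"
  by (simp add: rdom_def)

lemma rdomI: "(r, A) \<in> set R \<Longrightarrow> r |\<in>| rdom R"
  by (force simp: rdom_def fset_of_list_elem)

lemma rdomE: assumes "r |\<in>| rdom R" obtains A where "(r, A) \<in> set R"
  using assms by (auto simp: rdom_def fset_of_list_elem)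

inductive_cases wf_rctx_snocE: "wf_rctx (R @ [(r, A)])"
inductive_cases wf_ty_TUnitE: "wf_ty R TUnit"
inductive_cases wf_ty_TRegE: "wf_ty R (TReg r A)"
inductive_cases wf_ty_TFunE: "wf_ty R (TFun A e B)"

lemma wf_ty_rctx: "wf_ty R A \<Longrightarrow> wf_rctx R"
  by (induction A) (auto elim: wf_ty_TUnitE wf_ty_TRegE wf_ty_TFunE)

lemma wf_rctx_snocD: "wf_rctx (R @ [(r, A)]) \<Longrightarrow> wf_ty R A \<and> r |\<notin>| rdom R"
  by (auto elim: wf_rctx_snocE)

lemma wf_rctx_prefix: "wf_rctx (R @ R') \<Longrightarrow> wf_rctx R"
proof (induction R' rule: rev_induct)
  case (snoc p R')
  then have "wf_rctx ((R @ R') @ [(fst p, snd p)])" by simp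
  then have "wf_rctx (R @ R')" using wf_rctx_snocD wf_ty_rctx by blast
  then show ?case by (rule snoc.IH)
qed simp

lemma wf_rctx_middle: "wf_rctx (R @ (r, A) # R') \<Longrightarrow> wf_ty R A"
  using wf_rctx_prefix[of "R @ [(r, A)]" R'] wf_rctx_snocD by simp

lemma wf_rctx_distinct: "wf_rctx R \<Longrightarrow> distinct (map fst R)"
proof (induction R rule: rev_induct)
  case (snoc p R)
  have "wf_rctx R" using snoc.prems by (rule wf_rctx_prefix)
  moreover have "fst p |\<notin>| rdom R"
    using wf_rctx_snocD[of R "fst p" "snd p"] snoc.prems by simp
  ultimately show ?case using snoc.IH by (simp add: rdom_def fset_of_list.rep_eq)
qed simp

lemma wf_rctx_unique: "wf_rctx R \<Longrightarrow> (r, A) \<in> set R \<Longrightarrow> (r, B) \<in> set R \<Longrightarrow> A = B"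
  by (rule eq_key_imp_eq_value[OF wf_rctx_distinct])

lemma rext_refl: "wf_rctx R \<Longrightarrow> rext R R"
  by (simp add: rext_def)

lemma rext_trans: "rext R2 R1 \<Longrightarrow> rext R1 R \<Longrightarrow> rext R2 R"
  by (auto simp: rext_def)

lemma rext_wf: "rext R' R \<Longrightarrow> wf_rctx R'" "rext R' R \<Longrightarrow> wf_rctx R"
  by (auto simp: rext_def dest: wf_rctx_prefix)

lemma rext_set: "rext R' R \<Longrightarrow> set R \<subseteq> set R'"
  by (auto simp: rext_def)

lemma rext_rdom: "rext R' R \<Longrightarrow> rdom R |\<subseteq>| rdom R'"
  by (auto simp: rext_def)

lemma wf_ty_rext: "wf_ty R A \<Longrightarrow> rext R' R \<Longrightarrow> wf_ty R' A"
proof (induction A)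
  case TUnit
  then show ?case using rext_wf(1) by (blast intro: wf_unit)
next
  case (TReg r A)
  from TReg.prems(1) have "(r, A) \<in> set R" by (auto elim: wf_ty_TRegE)
  then show ?case using rext_wf(1)[OF TReg.prems(2)] rext_set[OF TReg.prems(2)] by (auto intro: wf_reg)
next
  case (TFun A e B)
  from TFun.prems(1) have "wf_ty R A" "wf_ty R B" "e |\<subseteq>| rdom R"
    by (auto elim: wf_ty_TFunE)
  then show ?case using TFun.IH TFun.prems(2) rext_rdom[OF TFun.prems(2)]
    by (intro wf_fun) auto
qed

text \<open>Makes the stratification usable: \<open>R0\<close> is the part of the context over which
  the type of \<open>r\<close> was formed, and at which the values stored in \<open>r\<close> are
  interpreted.\<close>

lemma rctx_split:
  assumes "wf_rctx R" "(r, A) \<in> set R"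
  obtains R0 R2 where "R = R0 @ (r, A) # R2" "wf_ty R0 A" "rext R R0"
proof -
  from assms(2) obtain R0 R2 where "R = R0 @ (r, A) # R2" by (auto dest: split_list)
  with assms(1) that wf_rctx_middle show ?thesis by (auto simp: rext_def)
qed

text \<open>The rule for \<open>TReg\<close> does not itself ask for \<open>A\<close> to be well
  formed. It is so at the prefix preceding \<open>r\<close>, and well-formedness survives
  extension.\<close>

lemma wf_ty_TReg:
  assumes "wf_ty R (TReg r A)"
  shows "wf_rctx R" "(r, A) \<in> set R" "wf_ty R A"
proof -
  from assms show wf: "wf_rctx R" by (rule wf_ty_rctx)
  from assms show mem: "(r, A) \<in> set R" by (auto elim: wf_ty_TRegE)
  from rctx_split[OF wf mem] obtain R0 where "wf_ty R0 A" "rext R R0" .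
  then show "wf_ty R A" by (rule wf_ty_rext)
qed

lemma wf_ty_TFun:
  assumes "wf_ty R (TFun A e B)"
  shows "wf_ty R A" "wf_ty R B" "e |\<subseteq>| rdom R"
  using assms by (auto elim: wf_ty_TFunE)

lemma wf_ctx_rext: "wf_ctx R \<Gamma> \<Longrightarrow> rext R' R \<Longrightarrow> wf_ctx R' \<Gamma>"
  unfolding wf_ctx_def using rext_wf(1) wf_ty_rext by blast

lemma subty_wf: "subty R A B \<Longrightarrow> wf_ty R A \<and> wf_ty R B"
proof (induction rule: subty.induct)
  case (subty_fun A' A B B' e e')
  have "e |\<subseteq>| rdom R" using subty_fun.hyps(3,4) by (rule order_trans)
  with subty_fun show ?case by (simp add: wf_fun)
qed simp

lemma subty_rext: "subty R A B \<Longrightarrow> rext R' R \<Longrightarrow> subty R' A B"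
proof (induction rule: subty.induct)
  case (subty_refl A)
  then show ?case by (rule subty.subty_refl[OF wf_ty_rext])
next
  case (subty_fun A' A B B' e e')
  have "e' |\<subseteq>| rdom R'"
    using subty_fun.hyps(4) rext_rdom[OF subty_fun.prems] by (rule order_trans)
  with subty_fun show ?case by (simp add: subty.subty_fun)
qed

lemma subty_base:
  "subty R TUnit B \<Longrightarrow> B = TUnit"
  "subty R A TUnit \<Longrightarrow> A = TUnit"
  "subty R (TReg r C) B \<Longrightarrow> B = TReg r C"
  "subty R A (TReg r C) \<Longrightarrow> A = TReg r C"
  by (erule subty.cases; simp)+

lemma subty_TFun:
  assumes "subty R (TFun A e B) T"
  obtains A' e' B' where "T = TFun A' e' B'" "subty R A' A" "subty R B B'" "e |\<subseteq>| e'"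
    "e' |\<subseteq>| rdom R"
  using assms
proof cases
  case subty_refl
  then have "wf_ty R (TFun A e B)" by simp
  from wf_ty_TFun[OF this] show ?thesis using that subty_refl subty.subty_refl by blast
qed (rule that; assumption)

lemma subty_TFun_right:
  assumes "subty R T (TFun A' e' B')"
  obtains A e B where "T = TFun A e B" "subty R A' A" "subty R B B'" "e |\<subseteq>| e'"
    "e' |\<subseteq>| rdom R"
  using assms
proof cases
  case subty_refl
  then have "wf_ty R (TFun A' e' B')" by simp
  from wf_ty_TFun[OF this] show ?thesis using that subty_refl subty.subty_refl by blast
qed (rule that; assumption)

text \<open>Induction on the middle type: contravariance exchanges the two outer types in the
  domain, so neither of them could be kept as the induction variable.\<close>

lemma subty_trans: "subty R A B \<Longrightarrow> subty R B C \<Longrightarrow> subty R A C"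
proof (induction B arbitrary: A C)
  case (TFun B1 e B2)
  obtain A1 d A2 where A: "A = TFun A1 d A2" "subty R B1 A1" "subty R A2 B2" "d |\<subseteq>| e"
    using TFun.prems(1) by (rule subty_TFun_right)
  obtain C1 f C2 where C: "C = TFun C1 f C2" "subty R C1 B1" "subty R B2 C2" "e |\<subseteq>| f"
    "f |\<subseteq>| rdom R"
    using TFun.prems(2) by (rule subty_TFun)
  show ?case unfolding A(1) C(1)
    by (rule subty_fun[OF TFun.IH(1)[OF C(2) A(2)] TFun.IH(2)[OF A(3) C(3)]
          order_trans[OF A(4) C(4)] C(5)])
next
  case TUnit
  then show ?case using subty_base(2)[OF TUnit(1)] by simp
next
  case (TReg r B)
  then show ?case using subty_base(4)[OF TReg(2)] by simp
qed

section \<open>Typing\<close>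

lemma typing_wf: "typing R \<Gamma> M X \<Longrightarrow> wf_ctx R \<Gamma> \<and> wf_ty R (fst X) \<and> snd X |\<subseteq>| rdom R"
proof (induction rule: typing.induct)
  case (ty_var \<Gamma> i A)
  then show ?case by (auto simp: wf_ctx_def)
next
  case (ty_loc \<Gamma> r A)
  then show ?case by (auto simp: wf_ctx_def intro: wf_reg)
next
  case (ty_star \<Gamma>)
  then show ?case by (auto simp: wf_ctx_def intro: wf_unit)
next
  case (ty_lam A \<Gamma> M B e)
  then show ?case by (auto simp: wf_ctx_def intro: wf_fun)
next
  case (ty_app \<Gamma> M A e2 B e1 N e3)
  then show ?case using wf_ty_TFun[of R A e2 B] by simp
next
  case (ty_get \<Gamma> M r A e)
  then show ?case using wf_ty_TReg[of R r A] rdomI[of r A R] by simp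
next
  case (ty_set \<Gamma> M r A e1 N e2)
  then show ?case using wf_ty_TReg[of R r A] rdomI[of r A R] by (simp add: wf_unit)
next
  case (ty_sub \<Gamma> M A e A' e')
  then show ?case using subty_wf[of R A A'] by (simp add: subty_eff_def)
qed

lemma typing_rext: "typing R \<Gamma> M X \<Longrightarrow> rext R' R \<Longrightarrow> typing R' \<Gamma> M X"
proof (induction rule: typing.induct)
  case (ty_sub \<Gamma> M A e A' e')
  then have "subty R' A A'" "e |\<subseteq>| e'" "e' |\<subseteq>| rdom R'"
    using subty_rext[of R A A' R'] order_trans[of e' "rdom R", OF _ rext_rdom[of R' R]]
    by (simp_all add: subty_eff_def)
  with ty_sub show ?case by (intro typing.ty_sub[of R' \<Gamma> M A e A' e']) (simp_all add: subty_eff_def)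
next
  case (ty_loc \<Gamma> r A)
  then have "(r, A) \<in> set R'" using rext_set by blast
  with ty_loc show ?case using wf_ctx_rext by (blast intro: typing.ty_loc)
next
  case (ty_var \<Gamma> i A)
  then show ?case using wf_ctx_rext by (blast intro: typing.ty_var)
next
  case (ty_star \<Gamma>)
  then show ?case using wf_ctx_rext by (blast intro: typing.ty_star)
next
  case (ty_lam A \<Gamma> M B e)
  then show ?case by (simp add: typing.ty_lam)
next
  case (ty_app \<Gamma> M A e2 B e1 N e3)
  then show ?case by (blast intro: typing.ty_app)
next
  case (ty_get \<Gamma> M r A e)
  then show ?case by (blast intro: typing.ty_get)
next
  case (ty_set \<Gamma> M r A e1 N e2)
  then show ?case by (blast intro: typing.ty_set)
qed

lemma typing_subtyI:
  "typing R \<Gamma> M (A, e) \<Longrightarrow> subty R A A' \<Longrightarrow> e |\<subseteq>| e' \<Longrightarrow> e' |\<subseteq>| rdom R \<Longrightarrow>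
    typing R \<Gamma> M (A', e')"
  by (rule ty_sub) (simp_all add: subty_eff_def)

lemma typing_effect_mono:
  "typing R \<Gamma> M (A, e) \<Longrightarrow> e |\<subseteq>| e' \<Longrightarrow> e' |\<subseteq>| rdom R \<Longrightarrow> typing R \<Gamma> M (A, e')"
  using typing_wf[of R \<Gamma> M "(A, e)"] typing_subtyI[of R \<Gamma> M A e A e'] subty_refl by simp

lemma typing_rename:
  "typing R \<Gamma> M X \<Longrightarrow> wf_ctx R \<Delta> \<Longrightarrow>
    (\<And>i. i < length \<Gamma> \<Longrightarrow> f i < length \<Delta> \<and> \<Delta> ! f i = \<Gamma> ! i) \<Longrightarrow> typing R \<Delta> (rename M f) X"
proof (induction arbitrary: \<Delta> f rule: typing.induct)
  case (ty_lam A \<Gamma> M B e)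
  have "wf_ctx R (A # \<Delta>)"
    using typing_wf[OF ty_lam.hyps] ty_lam.prems(1) by (simp add: wf_ctx_def)
  moreover have "lift_ren f i < length (A # \<Delta>) \<and> (A # \<Delta>) ! lift_ren f i = (A # \<Gamma>) ! i"
    if "i < length (A # \<Gamma>)" for i
    using that ty_lam.prems(2) by (cases i) auto
  ultimately show ?case by (auto intro!: typing.ty_lam ty_lam.IH)
next
  case (ty_sub \<Gamma> M A e A' e')
  then show ?case by (blast intro: typing.ty_sub)
next
  case (ty_get \<Gamma> M r A e)
  have "typing R \<Delta> (rename M f) (TReg r A, e)" by (intro ty_get.IH ty_get.prems)
  from typing.ty_get[OF this] show ?case by simp
next
  case (ty_set \<Gamma> M r A e1 N e2)
  have "typing R \<Delta> (rename M f) (TReg r A, e1)" "typing R \<Delta> (rename N f) (A, e2)"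
    by (intro ty_set.IH ty_set.prems; assumption)+
  from typing.ty_set[OF this] show ?case by simp
next
  case (ty_app \<Gamma> M A e2 B e1 N e3)
  have "typing R \<Delta> (rename M f) (TFun A e2 B, e1)" "typing R \<Delta> (rename N f) (A, e3)"
    by (intro ty_app.IH ty_app.prems; assumption)+
  from typing.ty_app[OF this] show ?case by simp
qed (simp_all add: typing.ty_var typing.ty_star typing.ty_loc)

text \<open>The substituted terms have the empty effect, like the variables they replace, so the
  effect of the result does not change.\<close>

lemma typing_subst:
  "typing R \<Gamma> M X \<Longrightarrow> wf_ctx R \<Delta> \<Longrightarrow>
    (\<And>i. i < length \<Gamma> \<Longrightarrow> typing R \<Delta> (s i) (\<Gamma> ! i, {||})) \<Longrightarrow> typing R \<Delta> (subst M s) X"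
proof (induction arbitrary: \<Delta> s rule: typing.induct)
  case (ty_lam A \<Gamma> M B e)
  have wf: "wf_ctx R (A # \<Delta>)"
    using typing_wf[OF ty_lam.hyps] ty_lam.prems(1) by (simp add: wf_ctx_def)
  have "typing R (A # \<Delta>) (lift_sub s i) ((A # \<Gamma>) ! i, {||})"
    if "i < length (A # \<Gamma>)" for i
    using that ty_lam.prems(2) wf
    by (cases i) (auto intro!: typing.ty_var typing_rename[where \<Gamma> = \<Delta>])
  with wf show ?case by (auto intro!: typing.ty_lam ty_lam.IH)
next
  case (ty_sub \<Gamma> M A e A' e')
  then show ?case by (blast intro: typing.ty_sub)
next
  case (ty_var \<Gamma> i A)
  from ty_var.prems(2)[OF ty_var.hyps(2)] ty_var.hyps(3) show ?case by simp
next
  case (ty_get \<Gamma> M r A e)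
  have "typing R \<Delta> (subst M s) (TReg r A, e)" by (intro ty_get.IH ty_get.prems)
  from typing.ty_get[OF this] show ?case by simp
next
  case (ty_set \<Gamma> M r A e1 N e2)
  have "typing R \<Delta> (subst M s) (TReg r A, e1)" "typing R \<Delta> (subst N s) (A, e2)"
    by (intro ty_set.IH ty_set.prems; assumption)+
  from typing.ty_set[OF this] show ?case by simp
next
  case (ty_app \<Gamma> M A e2 B e1 N e3)
  have "typing R \<Delta> (subst M s) (TFun A e2 B, e1)" "typing R \<Delta> (subst N s) (A, e3)"
    by (intro ty_app.IH ty_app.prems; assumption)+
  from typing.ty_app[OF this] show ?case by simp
qed (simp_all add: typing.ty_var typing.ty_star typing.ty_loc)

lemma typing_msubst:
  assumes "typing R \<Gamma> M X" "wf_rctx R" "length Vs = length \<Gamma>"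
    and "\<And>i. i < length \<Gamma> \<Longrightarrow> typing R [] (Val (Vs ! i)) (\<Gamma> ! i, {||})"
  shows "typing R [] (msubst Vs M) X"
  unfolding msubst_eq
  by (rule typing_subst[OF assms(1)]) (use assms in \<open>auto simp: wf_ctx_def value_sub_def\<close>)

text \<open>An effect on a value can only come from subsumption. Dropping it matters because a value
  reached from a term inherits the effect of that term, while arguments and stored values are
  interpreted at the empty effect.\<close>

lemma typing_Val_pure: "typing R \<Gamma> (Val V) (A, e) \<Longrightarrow> typing R \<Gamma> (Val V) (A, {||})"
proof (induction \<Gamma> "Val V" "(A, e)" arbitrary: A e rule: typing.induct)
  case (ty_sub \<Gamma> A e A' e')
  then show ?case by (auto simp: subty_eff_def intro: typing_subtyI)
qed (auto intro: typing.intros)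

section \<open>Inversion of typing, with repeated subsumption collapsed by transitivity\<close>

lemma typing_App_inv:
  assumes "typing R \<Gamma> (App M N) (B, e)"
  obtains A e1 e2 e3 B' where "typing R \<Gamma> M (TFun A e2 B', e1)" "typing R \<Gamma> N (A, e3)"
    "subty R B' B" "e1 |\<union>| e2 |\<union>| e3 |\<subseteq>| e"
proof -
  have "\<exists>A e1 e2 e3 B'. typing R \<Gamma> M (TFun A e2 B', e1) \<and> typing R \<Gamma> N (A, e3) \<and>
    subty R B' B \<and> e1 |\<union>| e2 |\<union>| e3 |\<subseteq>| e"
    using assms
  proof (induction \<Gamma> "App M N" "(B, e)" arbitrary: B e rule: typing.induct)
    case (ty_app \<Gamma> A e2 B e1 e3)
    then have "subty R B B"
      using typing_wf[OF ty_app.hyps(1)] wf_ty_TFun(2)[of R A e2 B] subty_refl by simp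
    with ty_app show ?case by (metis order_refl)
  next
    case (ty_sub \<Gamma> B e B' e')
    then obtain A e1 e2 e3 B0 where IH: "typing R \<Gamma> M (TFun A e2 B0, e1)" "typing R \<Gamma> N (A, e3)"
      "subty R B0 B" "e1 |\<union>| e2 |\<union>| e3 |\<subseteq>| e" by metis
    from ty_sub.hyps have le: "subty R B B'" "e |\<subseteq>| e'" by (simp_all add: subty_eff_def)
    show ?case using IH(1,2) subty_trans[OF IH(3) le(1)] order_trans[OF IH(4) le(2)] by metis
  qed
  with that show ?thesis by metis
qed

lemma typing_Get_inv:
  assumes "typing R \<Gamma> (Get M) (B, e)"
  obtains r A e1 where "typing R \<Gamma> M (TReg r A, e1)" "subty R A B" "e1 |\<union>| {|r|} |\<subseteq>| e"
proof -
  have "\<exists>r A e1. typing R \<Gamma> M (TReg r A, e1) \<and> subty R A B \<and> e1 |\<union>| {|r|} |\<subseteq>| e"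
    using assms
  proof (induction \<Gamma> "Get M" "(B, e)" arbitrary: B e rule: typing.induct)
    case (ty_get \<Gamma> r A e)
    then have "subty R A A"
      using typing_wf[OF ty_get.hyps(1)] wf_ty_TReg(3)[of R r A] subty_refl by simp
    with ty_get show ?case by (metis order_refl)
  next
    case (ty_sub \<Gamma> B e B' e')
    then obtain r A e1 where IH: "typing R \<Gamma> M (TReg r A, e1)" "subty R A B" "e1 |\<union>| {|r|} |\<subseteq>| e"
      by metis
    from ty_sub.hyps have le: "subty R B B'" "e |\<subseteq>| e'" by (simp_all add: subty_eff_def)
    show ?case using IH(1) subty_trans[OF IH(2) le(1)] order_trans[OF IH(3) le(2)] by metis
  qed
  with that show ?thesis by metis
qed

lemma typing_Set_inv:
  assumes "typing R \<Gamma> (Set M N) (B, e)"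
  obtains r A e1 e2 where "typing R \<Gamma> M (TReg r A, e1)" "typing R \<Gamma> N (A, e2)"
    "B = TUnit" "e1 |\<union>| e2 |\<union>| {|r|} |\<subseteq>| e"
proof -
  have "\<exists>r A e1 e2. typing R \<Gamma> M (TReg r A, e1) \<and> typing R \<Gamma> N (A, e2) \<and>
    B = TUnit \<and> e1 |\<union>| e2 |\<union>| {|r|} |\<subseteq>| e"
    using assms
  proof (induction \<Gamma> "Set M N" "(B, e)" arbitrary: B e rule: typing.induct)
    case (ty_set \<Gamma> r A e1 e2)
    then show ?case by (metis order_refl)
  next
    case (ty_sub \<Gamma> B e B' e')
    then obtain r A e1 e2 where IH: "typing R \<Gamma> M (TReg r A, e1)" "typing R \<Gamma> N (A, e2)"
      "B = TUnit" "e1 |\<union>| e2 |\<union>| {|r|} |\<subseteq>| e" by metis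
    from ty_sub.hyps have le: "subty R B B'" "e |\<subseteq>| e'" by (simp_all add: subty_eff_def)
    have "B' = TUnit" using le(1) IH(3) subty_base(1) by simp
    then show ?case using IH(1,2) order_trans[OF IH(4) le(2)] by metis
  qed
  with that show ?thesis by metis
qed

lemma typing_Loc_inv:
  assumes "typing R \<Gamma> (Val (Loc r)) (T, e)"
  obtains A where "T = TReg r A" "(r, A) \<in> set R"
proof -
  have "\<exists>A. T = TReg r A \<and> (r, A) \<in> set R"
    using assms
  proof (induction \<Gamma> "Val (Loc r)" "(T, e)" arbitrary: T e rule: typing.induct)
    case (ty_sub \<Gamma> A e A' e')
    then show ?case by (auto simp: subty_eff_def dest: subty_base)
  qed auto
  with that show ?thesis by metis
qed

lemma typing_Lam_inv:
  assumes "typing R \<Gamma> (Val (Lam M)) (T, e)"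
  obtains A0 B0 e0 where "typing R (A0 # \<Gamma>) M (B0, e0)" "subty R (TFun A0 e0 B0) T"
proof -
  have "\<exists>A0 B0 e0. typing R (A0 # \<Gamma>) M (B0, e0) \<and> subty R (TFun A0 e0 B0) T"
    using assms
  proof (induction \<Gamma> "Val (Lam M)" "(T, e)" arbitrary: T e rule: typing.induct)
    case (ty_lam A \<Gamma> B e)
    then have "wf_ty R (TFun A e B)"
      using typing_wf[OF ty_lam(1)] by (auto simp: wf_ctx_def intro: wf_fun)
    with ty_lam show ?case by (blast intro: subty_refl)
  next
    case (ty_sub \<Gamma> A e A' e')
    then show ?case by (auto simp: subty_eff_def intro: subty_trans)
  qed
  with that show ?thesis by metis
qed

section \<open>Subject reduction\<close>

text \<open>Regions declared in \<open>R\<close> may be unbound in \<open>S\<close>. This allows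
  \<open>den_store R R''\<close> to be typed at the longer context \<open>R''\<close>, where its
  values live.\<close>

definition store_typed :: "rctx \<Rightarrow> store \<Rightarrow> bool" where
  "store_typed R S \<longleftrightarrow> (\<forall>r A vs V. (r, A) \<in> set R \<longrightarrow> fmlookup S r = Some vs \<longrightarrow> V \<in> vs \<longrightarrow>
     typing R [] (Val V) (A, {||}))"

text \<open>Besides replacement in the hole, the bound on \<open>e1\<close> is essential: it places
  the effect of the redex inside the effect of the whole term.\<close>

lemma typing_plug:
  assumes "typing R \<Gamma> (plug E M) (A, e)"
  shows "\<exists>B e1. typing R \<Gamma> M (B, e1) \<and> e1 |\<subseteq>| e \<and>
    (\<forall>M'. typing R \<Gamma> M' (B, e1) \<longrightarrow> typing R \<Gamma> (plug E M') (A, e))"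
  using assms
proof (induction E arbitrary: A e)
  case Hole
  then show ?case by auto
next
  case (EAppL E N)
  from EAppL.prems obtain A1 e1 e2 e3 A' where
    1: "typing R \<Gamma> (plug E M) (TFun A1 e2 A', e1)" "typing R \<Gamma> N (A1, e3)" "subty R A' A"
      "e1 |\<union>| e2 |\<union>| e3 |\<subseteq>| e"
    by (auto elim: typing_App_inv)
  have "typing R \<Gamma> (App M' N) (A, e)" if "typing R \<Gamma> M' (TFun A1 e2 A', e1)" for M'
    using typing_subtyI[OF ty_app[OF that 1(2)] 1(3,4)] typing_wf[OF EAppL.prems] by simp
  moreover have "e1 |\<subseteq>| e" using 1(4) by simp
  ultimately show ?case using EAppL.IH[OF 1(1)] unfolding plug.simps by (meson order_trans)
next
  case (EAppR V E)
  from EAppR.prems obtain A1 e1 e2 e3 A' where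
    1: "typing R \<Gamma> (Val V) (TFun A1 e2 A', e1)" "typing R \<Gamma> (plug E M) (A1, e3)" "subty R A' A"
      "e1 |\<union>| e2 |\<union>| e3 |\<subseteq>| e"
    by (auto elim: typing_App_inv)
  have "typing R \<Gamma> (App (Val V) M') (A, e)" if "typing R \<Gamma> M' (A1, e3)" for M'
    using typing_subtyI[OF ty_app[OF 1(1) that] 1(3,4)] typing_wf[OF EAppR.prems] by simp
  moreover have "e3 |\<subseteq>| e" using 1(4) by simp
  ultimately show ?case using EAppR.IH[OF 1(2)] unfolding plug.simps by (meson order_trans)
next
  case (EGet E)
  from EGet.prems obtain r A1 e1 where
    1: "typing R \<Gamma> (plug E M) (TReg r A1, e1)" "subty R A1 A" "e1 |\<union>| {|r|} |\<subseteq>| e"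
    by (auto elim: typing_Get_inv)
  have "typing R \<Gamma> (Get M') (A, e)" if "typing R \<Gamma> M' (TReg r A1, e1)" for M'
    using typing_subtyI[OF ty_get[OF that] 1(2,3)] typing_wf[OF EGet.prems] by simp
  moreover have "e1 |\<subseteq>| e" using 1(3) by simp
  ultimately show ?case using EGet.IH[OF 1(1)] unfolding plug.simps by (meson order_trans)
next
  case (ESetL E N)
  from ESetL.prems obtain r A1 e1 e2 where
    1: "typing R \<Gamma> (plug E M) (TReg r A1, e1)" "typing R \<Gamma> N (A1, e2)" "A = TUnit"
      "e1 |\<union>| e2 |\<union>| {|r|} |\<subseteq>| e"
    by (auto elim: typing_Set_inv)
  have "typing R \<Gamma> (Set M' N) (A, e)" if "typing R \<Gamma> M' (TReg r A1, e1)" for M'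
    using typing_effect_mono[OF ty_set[OF that 1(2)] 1(4)] typing_wf[OF ESetL.prems] 1(3) by simp
  moreover have "e1 |\<subseteq>| e" using 1(4) by simp
  ultimately show ?case using ESetL.IH[OF 1(1)] unfolding plug.simps by (meson order_trans)
next
  case (ESetR V E)
  from ESetR.prems obtain r A1 e1 e2 where
    1: "typing R \<Gamma> (Val V) (TReg r A1, e1)" "typing R \<Gamma> (plug E M) (A1, e2)" "A = TUnit"
      "e1 |\<union>| e2 |\<union>| {|r|} |\<subseteq>| e"
    by (auto elim: typing_Set_inv)
  have "typing R \<Gamma> (Set (Val V) M') (A, e)" if "typing R \<Gamma> M' (A1, e2)" for M'
    using typing_effect_mono[OF ty_set[OF 1(1) that] 1(4)] typing_wf[OF ESetR.prems] 1(3) by simp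
  moreover have "e2 |\<subseteq>| e" using 1(4) by simp
  ultimately show ?case using ESetR.IH[OF 1(2)] unfolding plug.simps by (meson order_trans)
qed

lemma typing_head_red:
  assumes "head_red M S M' S'" "typing R [] M (A, e)" "store_typed R S"
  shows "typing R [] M' (A, e)"
  using assms(1)
proof cases
  case (head_beta N V)
  from assms(2)[unfolded head_beta] obtain A1 e1 e2 e3 A' where
    1: "typing R [] (Val (Lam N)) (TFun A1 e2 A', e1)" "typing R [] (Val V) (A1, e3)"
      "subty R A' A" "e1 |\<union>| e2 |\<union>| e3 |\<subseteq>| e"
    by (auto elim: typing_App_inv)
  from 1(1) obtain A0 B0 e0 where
    2: "typing R [A0] N (B0, e0)" "subty R (TFun A0 e0 B0) (TFun A1 e2 A')"
    by (auto elim: typing_Lam_inv)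
  from 2(2) have 3: "subty R A1 A0" "subty R B0 A'" "e0 |\<subseteq>| e2"
    by (auto elim: subty_TFun)
  have "typing R [] (Val V) (A0, {||})"
    using typing_subtyI[OF typing_Val_pure[OF 1(2)] 3(1)] by simp
  then have "typing R [] (msubst [V] N) (B0, e0)"
    using typing_msubst[OF 2(1), of "[V]"] typing_wf[OF assms(2)] by (simp add: wf_ctx_def)
  moreover have "subty R B0 A" using 3(2) 1(3) by (rule subty_trans)
  moreover have "e0 |\<subseteq>| e" using 3(3) 1(4) by auto
  ultimately show ?thesis
    using typing_subtyI typing_wf[OF assms(2)] head_beta by simp
next
  case (head_get r V)
  from assms(2)[unfolded head_get] obtain q A1 e1 where
    1: "typing R [] (Val (Loc r)) (TReg q A1, e1)" "subty R A1 A"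
    by (auto elim: typing_Get_inv)
  then have "(r, A1) \<in> set R" by (auto elim: typing_Loc_inv)
  then have "typing R [] (Val V) (A1, {||})"
    using assms(3) head_get(4) by (auto simp: store_typed_def store_union_single_absorb)
  then show ?thesis
    using typing_subtyI[OF _ 1(2)] typing_wf[OF assms(2)] head_get by simp
next
  case (head_set r V)
  from assms(2)[unfolded head_set] have "A = TUnit" by (auto elim: typing_Set_inv)
  then show ?thesis using head_set typing_wf[OF assms(2)] typing_effect_mono[OF ty_star] by simp
qed

lemma typing_red:
  assumes "red M S M' S'" "typing R [] M (A, e)" "store_typed R S"
  shows "typing R [] M' (A, e)"
  using assms(1)
proof cases
  case (red_plug h h' E)
  with typing_plug assms(2) typing_head_red[OF red_plug(3)] assms(3) show ?thesis by metis
qed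

text \<open>Convergence keeps the store fixed, so one typing assumption on \<open>S\<close> serves
  every step.\<close>

lemma typing_converges:
  assumes "converges S P M" "typing R [] M (A, e)" "store_typed R S"
  shows "converges S (\<lambda>N. P N \<and> typing R [] N (A, e)) M"
  using assms(1,2)
proof (induction rule: converges.induct)
  case (convergesI M)
  show ?case
  proof (rule converges.convergesI)
    show "S' = S \<and> converges S (\<lambda>N. P N \<and> typing R [] N (A, e)) M'" if "red M S M' S'" for M' S'
      using convergesI.IH[OF that] typing_red[OF that convergesI.prems assms(3)] by blast
  qed (use convergesI in blast)
qed

text \<open>The redex touches only a region in the effect of the whole term, so agreement on
  \<open>e\<close> lets the same step be replayed at \<open>T\<close>. The implication in the
  conclusion carries preservation of the store back from \<open>T\<close> to
  \<open>S\<close>.\<close>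

lemma red_store_cong:
  assumes "red M S M' S'" "typing R [] M (A, e)"
    and "\<And>r. r |\<in>| e \<Longrightarrow> fmlookup S r = fmlookup T r"
  shows "\<exists>T'. red M T M' T' \<and> (T' = T \<longrightarrow> S' = S)"
  using assms(1)
proof cases
  case (red_plug h h' E)
  then obtain B e1 where h: "typing R [] h (B, e1)" "e1 |\<subseteq>| e"
    using typing_plug assms(2) by blast
  have absorb: "store_union (single r V) S = S \<longleftrightarrow> store_union (single r V) T = T"
    if "r |\<in>| e" for r V
    using assms(3)[OF that] by (simp add: store_union_single_absorb)
  from red_plug(3) have "\<exists>T'. head_red h T h' T' \<and> (T' = T \<longrightarrow> S' = S)"
  proof cases
    case (head_beta N V)
    then show ?thesis by (auto intro: head_red.intros)
  next
    case (head_get r V)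
    \<comment> \<open>Subtyping leaves \<open>TReg\<close> types alone, so the region in the type of
      \<open>Loc r\<close>, which the rule for reads adds to the effect, is \<open>r\<close>
      itself.\<close>
    from h(1)[unfolded head_get] have "r |\<in>| e1"
      by (auto elim!: typing_Get_inv typing_Loc_inv)
    then have "store_union (single r V) T = T" using head_get absorb h(2) by auto
    then show ?thesis using head_red.head_get[of r V T] head_get by auto
  next
    case (head_set r V)
    from h(1)[unfolded head_set] have "r |\<in>| e1"
      by (auto elim!: typing_Set_inv typing_Loc_inv)
    then show ?thesis using head_red.head_set[of r V T] head_set absorb h(2) by auto
  qed
  then show ?thesis using red_plug by (auto intro: red.intros)
qed

lemma converges_store_cong:
  assumes "converges S P M" "typing R [] M (A, e)" "store_typed R S"
    and "\<And>r. r |\<in>| e \<Longrightarrow> fmlookup S r = fmlookup T r"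
  shows "converges T P M"
  using assms(1,2)
proof (induction rule: converges.induct)
  case (convergesI M)
  show ?case
  proof (rule converges.convergesI)
    fix M' T'
    assume "red M T M' T'"
    \<comment> \<open>Steps at \<open>T\<close> are pulled back to \<open>S\<close>, where the
      induction hypothesis and the typed store are available.\<close>
    then obtain S' where S': "red M S M' S'" "S' = S \<longrightarrow> T' = T"
      using red_store_cong convergesI.prems assms(4) by metis
    with convergesI.IH[OF S'(1)] typing_red[OF S'(1) convergesI.prems assms(3)]
    show "T' = T \<and> converges T P M'" by blast
  next
    assume "\<And>M' T'. \<not> red M T M' T'"
    then show "P M"
      using convergesI.hyps red_store_cong[OF _ convergesI.prems assms(4)] by blast
  qed
qed

section \<open>The interpretation\<close>

lemma den_rctx_iff:
  "(R', S) \<in> den_rctx R \<longleftrightarrow> rext R' R \<and> fmdom S = rdom R \<and>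
     (\<forall>i < length R. fmlookup S (fst (R ! i)) =
        Some {V. (R', Val V) \<in> den_ty (take i R) (snd (R ! i)) {||}})"
  by (subst den_rctx.simps) simp

lemma den_rctx_unique:
  assumes "(R', S) \<in> den_rctx R" "(R', T) \<in> den_rctx R" shows "S = T"
proof (rule fmap_ext)
  fix r
  show "fmlookup S r = fmlookup T r"
  proof (cases "r |\<in>| rdom R")
    case True
    then obtain i where "i < length R" "r = fst (R ! i)"
      by (auto elim!: rdomE simp: in_set_conv_nth)
    then show ?thesis using assms by (simp add: den_rctx_iff)
  next
    case False
    then have "r |\<notin>| fmdom S" "r |\<notin>| fmdom T" using assms by (simp_all add: den_rctx_iff)
    then show ?thesis by (simp add: fmdom_notD)
  qed
qed

text \<open>Justifies the definite description in \<open>den_store\<close>. The equations for the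
  single regions cannot conflict because a well-formed context declares each region once.\<close>

lemma den_rctx_exists:
  assumes "rext R' R" shows "\<exists>S. (R', S) \<in> den_rctx R"
proof
  define vals where "vals i = {V. (R', Val V) \<in> den_ty (take i R) (snd (R ! i)) {||}}" for i
  define xs where "xs = map (\<lambda>i. (fst (R ! i), vals i)) [0..<length R]"
  have fsts: "map fst xs = map fst R"
    by (auto simp: xs_def intro: nth_equalityI)
  then have "distinct (map fst xs)"
    using assms by (simp add: rext_wf wf_rctx_distinct)
  then have "fmlookup (fmap_of_list xs) (fst (R ! i)) = Some (vals i)" if "i < length R" for i
    using that by (auto simp: fmlookup_of_list xs_def intro!: map_of_is_SomeI)
  moreover have "fmdom (fmap_of_list xs) = rdom R"
    by (simp add: fsts rdom_def flip: fset_of_list_map)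
  ultimately show "(R', fmap_of_list xs) \<in> den_rctx R"
    using assms by (simp add: den_rctx_iff vals_def)
qed

lemma den_store_in: "rext R' R \<Longrightarrow> (R', den_store R R') \<in> den_rctx R"
  unfolding den_store.simps by (rule theI') (blast dest: den_rctx_exists den_rctx_unique)

lemma fmdom_den_store: "rext R' R \<Longrightarrow> fmdom (den_store R R') = rdom R"
  using den_store_in by (simp add: den_rctx_iff)

lemma den_store_lookup:
  assumes "rext R' R" "R = R0 @ (r, A) # R2"
  shows "fmlookup (den_store R R') r = Some {V. (R', Val V) \<in> den_ty R0 A {||}}"
proof -
  have "length R0 < length R" "R ! length R0 = (r, A)" "take (length R0) R = R0"
    using assms(2) by auto
  with den_store_in[OF assms(1)] show ?thesis
    unfolding den_rctx_iff by (metis fst_conv snd_conv)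
qed

text \<open>The condition C(A, R, R'', M') on outcomes, named so that it can serve as the
  postcondition of \<open>converges\<close>.\<close>

definition good_result :: "rctx \<Rightarrow> rctx \<Rightarrow> ty \<Rightarrow> trm \<Rightarrow> bool" where
  "good_result R R'' A M' \<longleftrightarrow>
     (case A of
        TUnit \<Rightarrow> M' = Val Star
      | TReg r B \<Rightarrow> M' = Val (Loc r)
      | TFun A1 e' A2 \<Rightarrow>
          (\<exists>N. M' = Val (Lam N)) \<and>
          (\<forall>R1 V. rext R1 R'' \<longrightarrow> (R1, Val V) \<in> den_ty R A1 {||} \<longrightarrow>
             (R1, App M' (Val V)) \<in> den_ty R A2 e'))"

lemma good_result_simps:
  "good_result R R'' TUnit M \<longleftrightarrow> M = Val Star"
  "good_result R R'' (TReg r B) M \<longleftrightarrow> M = Val (Loc r)"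
  "good_result R R'' (TFun A1 e' A2) M \<longleftrightarrow> (\<exists>N. M = Val (Lam N)) \<and>
     (\<forall>R1 V. rext R1 R'' \<longrightarrow> (R1, Val V) \<in> den_ty R A1 {||} \<longrightarrow>
        (R1, App M (Val V)) \<in> den_ty R A2 e')"
  by (simp_all add: good_result_def)

text \<open>Clauses (2) and (3) merge into one convergence statement; the proofs below work with
  this form.\<close>

lemma den_ty_iff:
  "(R', M) \<in> den_ty R A e \<longleftrightarrow> rext R' R \<and> typing R' [] M (A, e) \<and>
     (\<forall>R''. rext R'' R' \<longrightarrow> converges (den_store R R'') (good_result R R'' A) M)"
  by (subst den_ty.simps, unfold converges_iff good_result_def) blast

lemma den_ty_typing: "(R', M) \<in> den_ty R A e \<Longrightarrow> typing R' [] M (A, e)"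
  by (simp add: den_ty_iff)

lemma den_ty_converges:
  "(R', M) \<in> den_ty R A e \<Longrightarrow> rext R'' R' \<Longrightarrow>
    converges (den_store R R'') (good_result R R'' A) M"
  by (simp add: den_ty_iff)

lemma good_result_Val: "good_result R R'' A M \<Longrightarrow> \<exists>V. M = Val V"
  by (auto simp: good_result_def split: ty.splits)

text \<open>Holds because the function clause already ranges over all extensions of
  \<open>R1\<close>, and those of \<open>R2\<close> are among them.\<close>

lemma good_result_rext:
  assumes "good_result R R1 A M" "rext R2 R1"
  shows "good_result R R2 A M"
  using assms rext_trans[OF _ assms(2)] by (cases A) (auto simp: good_result_simps)

lemma den_ty_rext:
  assumes "(R1, M) \<in> den_ty R A e" "rext R2 R1"
  shows "(R2, M) \<in> den_ty R A e"
  using assms rext_trans[OF _ assms(2)] rext_trans[OF assms(2), of R] typing_rext[OF _ assms(2)]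
  by (simp add: den_ty_iff)

lemma den_ty_Val_iff:
  "(R', Val V) \<in> den_ty R A e \<longleftrightarrow>
     rext R' R \<and> typing R' [] (Val V) (A, e) \<and> good_result R R' A (Val V)"
  unfolding den_ty_iff converges_Val
  using good_result_rext rext_refl rext_wf(1) by blast

text \<open>Closure under head expansion: the redex has exactly one reduct and reaches it without
  touching the store.\<close>

lemma converges_beta:
  assumes "converges S P (msubst [V] N)"
  shows "converges S P (App (Val (Lam N)) (Val V))"
proof (rule convergesI)
  show "S' = S \<and> converges S P M'" if "red (App (Val (Lam N)) (Val V)) S M' S'" for M' S'
    using red_App_Val[OF that] assms by (auto elim: head_red.cases)
  have "red (App (Val (Lam N)) (Val V)) S (msubst [V] N) S"
    using red_plug[OF head_beta[of N V S], of Hole] by simp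
  then show "P (App (Val (Lam N)) (Val V))" if "\<And>M' S'. \<not> red (App (Val (Lam N)) (Val V)) S M' S'"
    using that by blast
qed

lemma den_ty_beta:
  assumes "(R', msubst [V] N) \<in> den_ty R B e" "typing R' [] (App (Val (Lam N)) (Val V)) (B, e)"
  shows "(R', App (Val (Lam N)) (Val V)) \<in> den_ty R B e"
  using assms converges_beta by (simp add: den_ty_iff)

text \<open>Stored values satisfy clause (1) of the interpretation, which types them at
  \<open>R'\<close>. Since regions are declared once, the type given to \<open>r\<close> by
  \<open>R'\<close> is the one given by \<open>R\<close>.\<close>

lemma store_typed_den_store:
  assumes "rext R' R"
  shows "store_typed R' (den_store R R')"
  unfolding store_typed_def
proof (intro allI impI)
  fix r A vs V
  assume *: "(r, A) \<in> set R'" "fmlookup (den_store R R') r = Some vs" "V \<in> vs"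
  then have "r |\<in>| rdom R" using fmdom_den_store[OF assms] fmdomI by metis
  then obtain A' where A': "(r, A') \<in> set R" by (rule rdomE)
  then have "A' = A" using wf_rctx_unique rext_wf(1) rext_set assms *(1) by blast
  obtain R0 R2 where "R = R0 @ (r, A') # R2" using A' by (auto dest: split_list)
  from den_store_lookup[OF assms this] * \<open>A' = A\<close> show "typing R' [] (Val V) (A, {||})"
    by (auto simp: den_ty_iff)
qed

text \<open>Outcome and type together put a resulting value back into the interpretation, as
  required of function arguments and of values to be written.\<close>

lemma den_ty_typed_converges:
  assumes "(R', M) \<in> den_ty R A e" "rext R'' R'"
  shows "converges (den_store R R'') (\<lambda>N. good_result R R'' A N \<and> typing R'' [] N (A, e)) M"
proof -
  from assms have "typing R'' [] M (A, e)" "rext R'' R"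
    by (auto simp: den_ty_iff intro: typing_rext rext_trans)
  then show ?thesis
    using typing_converges[OF den_ty_converges[OF assms]] store_typed_den_store by blast
qed

text \<open>Reading from a region whose set of values is empty would be stuck, so every type must be
  inhabited.\<close>

primrec default_val :: "ty \<Rightarrow> val" where
  "default_val TUnit = Star"
| "default_val (TReg r A) = Loc r"
| "default_val (TFun A e B) = Lam (Val (default_val B))"

lemma subst_default_val: "subst_val (default_val A) s = default_val A"
  by (induction A arbitrary: s) auto

lemma typing_default_val:
  "wf_ty R A \<Longrightarrow> wf_ctx R \<Gamma> \<Longrightarrow> typing R \<Gamma> (Val (default_val A)) (A, {||})"
proof (induction A arbitrary: \<Gamma>)
  case TUnit
  then show ?case by (simp add: ty_star)
next
  case (TReg r A)
  then show ?case using wf_ty_TReg(2) by (auto intro: ty_loc)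
next
  case (TFun A e B)
  note wf = wf_ty_TFun[OF TFun.prems(1)]
  have "typing R (A # \<Gamma>) (Val (default_val B)) (B, {||})"
    using TFun.IH(2) wf TFun.prems(2) by (simp add: wf_ctx_def)
  from typing_effect_mono[OF this _ wf(3)] show ?case by (auto intro: ty_lam)
qed

text \<open>At a function type the constant function beta-reduces to the default value of the
  codomain. No region is touched, so the latent effect \<open>e\<close> is reached by
  weakening.\<close>

lemma den_ty_default_val:
  "wf_ty R A \<Longrightarrow> rext R' R \<Longrightarrow> (R', Val (default_val A)) \<in> den_ty R A {||}"
proof (induction A arbitrary: R')
  case (TFun A e B)
  note wf = wf_ty_TFun[OF TFun.prems(1)]
  have fun_typed: "typing R1 [] (Val (default_val (TFun A e B))) (TFun A e B, {||})"
    if "rext R1 R" for R1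
    using typing_default_val[OF wf_ty_rext[OF TFun.prems(1) that]] that
    by (simp add: wf_ctx_def rext_wf(1))
  have "(R1, App (Val (Lam (Val (default_val B)))) (Val V)) \<in> den_ty R B e"
    if "rext R1 R'" "(R1, Val V) \<in> den_ty R A {||}" for R1 V
  proof (rule den_ty_beta)
    have R1: "rext R1 R" using that(1) TFun.prems(2) by (rule rext_trans)
    have "typing R1 [] (Val V) (A, {||})" using that(2) by (simp add: den_ty_iff)
    from ty_app[OF fun_typed[OF R1] this]
    show "typing R1 [] (App (Val (Lam (Val (default_val B)))) (Val V)) (B, e)" by simp
    have B: "(R1, Val (default_val B)) \<in> den_ty R B {||}" using TFun.IH(2) wf(2) R1 by blast
    have "e |\<subseteq>| rdom R1" using wf(3) rext_rdom[OF R1] by (rule order_trans)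
    with B have "(R1, Val (default_val B)) \<in> den_ty R B e"
      using typing_effect_mono[of R1 "[]" "Val (default_val B)" B "{||}" e]
      by (simp add: den_ty_iff)
    then show "(R1, msubst [V] (Val (default_val B))) \<in> den_ty R B e"
      by (simp add: msubst_eq subst_default_val)
  qed
  then show ?case
    using fun_typed[OF TFun.prems(2)] TFun.prems(2) by (simp add: den_ty_Val_iff good_result_simps)
next
  case TUnit
  then show ?case using typing_default_val[OF wf_ty_rext[OF TUnit]]
    by (simp add: den_ty_Val_iff good_result_simps wf_ctx_def rext_wf(1))
next
  case (TReg r A)
  then show ?case using typing_default_val[OF wf_ty_rext[OF TReg(2,3)]]
    by (simp add: den_ty_Val_iff good_result_simps wf_ctx_def rext_wf(1))
qed

text \<open>Both contexts have the same prefix before \<open>r\<close>, and the two entries are the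
  same set by definition.\<close>

lemma den_store_agree:
  assumes "rext R1 R" "rext R' R1" "r |\<in>| rdom R"
  shows "fmlookup (den_store R1 R') r = fmlookup (den_store R R') r"
proof -
  from assms(3) obtain A where "(r, A) \<in> set R" by (rule rdomE)
  then obtain R0 R2 where R: "R = R0 @ (r, A) # R2" by (auto dest: split_list)
  obtain R3 where "R1 = R0 @ (r, A) # (R2 @ R3)" using assms(1) R by (auto simp: rext_def)
  from den_store_lookup[OF assms(2) this] den_store_lookup[OF rext_trans[OF assms(2,1)] R]
  show ?thesis by simp
qed

text \<open>Values stored in a region are interpreted at a shorter context than the one at which they
  are read and written.\<close>

lemma den_ty_stable:
  assumes "rext R1 R"
  shows "wf_ty R A \<Longrightarrow> e |\<subseteq>| rdom R \<Longrightarrow> rext R' R1 \<Longrightarrow>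
    (R', M) \<in> den_ty R1 A e \<longleftrightarrow> (R', M) \<in> den_ty R A e"
proof (induction A arbitrary: e R' M rule: ty.induct)
  \<comment> \<open>Reduces the claim to agreement of outcomes: \<open>e\<close> lies in the domain
    of \<open>R\<close>, so the two stores coincide on it and convergence transfers in both
    directions.\<close>
  have main: "(R', M) \<in> den_ty R1 A e \<longleftrightarrow> (R', M) \<in> den_ty R A e"
    if gr: "\<And>R'' N. rext R'' R1 \<Longrightarrow> good_result R1 R'' A N \<longleftrightarrow> good_result R R'' A N"
      and e: "e |\<subseteq>| rdom R" and R': "rext R' R1" for A e R' M
  proof -
    have "converges (den_store R1 R'') (good_result R1 R'' A) M \<longleftrightarrow>
        converges (den_store R R'') (good_result R R'' A) M"
      if "typing R' [] M (A, e)" "rext R'' R'" for R''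
    proof -
      have R'': "rext R'' R1" "rext R'' R"
        using rext_trans that(2) R' assms by blast+
      have typed: "typing R'' [] M (A, e)" using that by (rule typing_rext)
      have agree: "fmlookup (den_store R1 R'') r = fmlookup (den_store R R'') r"
        if "r |\<in>| e" for r
        using den_store_agree[OF assms R''(1)] that e by blast
      have "good_result R1 R'' A = good_result R R'' A"
        using gr[OF R''(1)] by (simp add: fun_eq_iff)
      then show ?thesis
        using converges_store_cong[OF _ typed store_typed_den_store[OF R''(1)] agree]
          converges_store_cong[OF _ typed store_typed_den_store[OF R''(2)] agree[symmetric]]
        by metis
    qed
    then show ?thesis
      using R' rext_trans[OF R' assms] unfolding den_ty_iff by blast
  qed
  {
    case TUnit
    then show ?case by (intro main) (simp_all add: good_result_simps)
  next
    case (TReg r A)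
    then show ?case by (intro main) (simp_all add: good_result_simps)
  next
    case (TFun A d B)
    note wf = wf_ty_TFun[OF TFun.prems(1)]
    show ?case
    proof (rule main)
      fix R'' N
      assume R'': "rext R'' R1"
      \<comment> \<open>Well-formedness at \<open>R\<close> bounds the latent effect
        \<open>d\<close> by the domain of \<open>R\<close>, as the induction hypothesis for the
        codomain demands.\<close>
      have "(R2, Val V) \<in> den_ty R1 A {||} \<longleftrightarrow> (R2, Val V) \<in> den_ty R A {||}"
        "(R2, App N (Val V)) \<in> den_ty R1 B d \<longleftrightarrow> (R2, App N (Val V)) \<in> den_ty R B d"
        if "rext R2 R''" for R2 V
        using TFun.IH wf rext_trans[OF that R''] by simp_all
      then show "good_result R1 R'' (TFun A d B) N \<longleftrightarrow> good_result R R'' (TFun A d B) N"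
        by (simp add: good_result_simps cong: imp_cong)
    qed (use TFun.prems in simp_all)
  }
qed

text \<open>Moves the description of the stored values from the prefix to \<open>R\<close>. Values
  read are good by one direction of the equivalence, and values written are absorbed by the
  other.\<close>

lemma den_store_mem:
  assumes "wf_ty R (TReg r A)" "rext R' R"
  obtains vs where "fmlookup (den_store R R') r = Some vs"
    "\<And>V. V \<in> vs \<longleftrightarrow> (R', Val V) \<in> den_ty R A {||}"
proof -
  obtain R0 R2 where R: "R = R0 @ (r, A) # R2" "wf_ty R0 A" "rext R R0"
    using wf_ty_TReg(1,2)[OF assms(1)] by (rule rctx_split)
  have "(R', Val V) \<in> den_ty R A {||} \<longleftrightarrow> (R', Val V) \<in> den_ty R0 A {||}" for V
    using den_ty_stable[OF R(3,2) _ assms(2)] by simp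
  with that den_store_lookup[OF assms(2) R(1)] show ?thesis by simp
qed

section \<open>Semantic counterparts of the typing rules\<close>

text \<open>\<open>R\<close> stays the same, so both interpretations evaluate \<open>M\<close> at
  the same store and subsumption only weakens the postcondition.\<close>

lemma den_ty_subty:
  "subty R A A' \<Longrightarrow> e |\<subseteq>| e' \<Longrightarrow> e' |\<subseteq>| rdom R \<Longrightarrow> (R', M) \<in> den_ty R A e \<Longrightarrow>
    (R', M) \<in> den_ty R A' e'"
proof (induction arbitrary: e e' R' M rule: subty.induct)
  have main: "(R', M) \<in> den_ty R A' e'"
    if gr: "\<And>R'' N. good_result R R'' A N \<Longrightarrow> good_result R R'' A' N"
      and "subty R A A'" "e |\<subseteq>| e'" "e' |\<subseteq>| rdom R" and M: "(R', M) \<in> den_ty R A e"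
    for A A' e e' R' M
  proof -
    have R': "rext R' R" using M by (simp add: den_ty_iff)
    have "e' |\<subseteq>| rdom R'" using that(4) rext_rdom[OF R'] by (rule order_trans)
    with M have "typing R' [] M (A', e')"
      using typing_subtyI[OF _ subty_rext[OF that(2) R'] that(3)] by (simp add: den_ty_iff)
    moreover have "converges (den_store R R'') (good_result R R'' A') M" if "rext R'' R'" for R''
      using den_ty_converges[OF M that] gr by (rule converges_mono)
    ultimately show ?thesis using R' unfolding den_ty_iff by blast
  qed
  {
    case (subty_refl A)
    then show ?case using main[OF _ subty.subty_refl] by blast
  next
    case (subty_fun A' A B B' d d')
    show ?case
    proof (rule main[OF _ _ subty_fun.prems])
      show "subty R (TFun A d B) (TFun A' d' B')" using subty_fun.hyps by (rule subty.subty_fun)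
      show "good_result R R'' (TFun A' d' B') N" if "good_result R R'' (TFun A d B) N" for R'' N
        using that subty_fun.IH(1)[of "{||}" "{||}"] subty_fun.IH(2)[OF subty_fun.hyps(3,4)]
        by (simp add: good_result_simps)
    qed
  }
qed

lemma den_ty_App:
  assumes M: "(R', M) \<in> den_ty R (TFun A e2 B) e1" and N: "(R', N) \<in> den_ty R A e3"
  shows "(R', App M N) \<in> den_ty R B (e1 |\<union>| e2 |\<union>| e3)"
proof -
  have "converges (den_store R R'') (good_result R R'' B) (App M N)" if R'': "rext R'' R'" for R''
  proof -
    let ?conv = "converges (den_store R R'') (good_result R R'' B)"
    have "?conv (plug (EAppL Hole N) M)"
    proof (rule converges_plug[OF den_ty_converges[OF M R'']])
      fix V
      assume V: "good_result R R'' (TFun A e2 B) (Val V)"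
      have "?conv (plug (EAppR V Hole) N)"
      \<comment> \<open>The outcome of \<open>N\<close> is taken with its type: only then is
        \<open>W\<close> in the interpretation of \<open>A\<close>, so that the clause for
        \<open>V\<close> applies, at \<open>R''\<close> as an extension of itself.\<close>
      proof (rule converges_plug[OF den_ty_typed_converges[OF N R'']])
        fix W
        assume "good_result R R'' A (Val W) \<and> typing R'' [] (Val W) (A, e3)"
        then have "(R'', Val W) \<in> den_ty R A {||}"
          using typing_Val_pure N rext_trans[OF R''] by (auto simp: den_ty_Val_iff den_ty_iff[of R' N])
        then have "(R'', App (Val V) (Val W)) \<in> den_ty R B e2"
          using V rext_refl[OF rext_wf(1)[OF R'']] by (simp add: good_result_simps)
        then show "?conv (plug (EAppR V Hole) (Val W))"
          using den_ty_converges rext_refl[OF rext_wf(1)[OF R'']] by simp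
      qed (use good_result_Val in blast)
      then show "?conv (plug (EAppL Hole N) (Val V))" by simp
    qed (rule good_result_Val)
    then show ?thesis by simp
  qed
  moreover have "typing R' [] (App M N) (B, e1 |\<union>| e2 |\<union>| e3)"
    using M N by (intro ty_app den_ty_typing)
  moreover have "rext R' R" using M by (simp add: den_ty_iff)
  ultimately show ?thesis unfolding den_ty_iff by blast
qed

lemma den_ty_Get:
  assumes M: "(R', M) \<in> den_ty R (TReg r A) e" and wf: "wf_ty R (TReg r A)"
  shows "(R', Get M) \<in> den_ty R A (e |\<union>| {|r|})"
proof -
  have R': "rext R' R" using M by (simp add: den_ty_iff)
  have "converges (den_store R R'') (good_result R R'' A) (Get M)" if R'': "rext R'' R'" for R''
  proof -
    let ?S = "den_store R R''"
    let ?conv = "converges ?S (good_result R R'' A)"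
    have R''R: "rext R'' R" using R'' R' by (rule rext_trans)
    obtain vs where vs: "fmlookup ?S r = Some vs" "\<And>V. V \<in> vs \<longleftrightarrow> (R'', Val V) \<in> den_ty R A {||}"
      using wf R''R by (rule den_store_mem) blast
    have loc: "?conv (Get (Val (Loc r)))"
    proof (rule convergesI)
      fix M' S'
      assume "red (Get (Val (Loc r))) ?S M' S'"
      then have "head_red (Get (Val (Loc r))) ?S M' S'" by (rule red_Get_Val)
      then obtain V where "M' = Val V" "S' = ?S" "V \<in> vs"
        by cases (use vs(1) in \<open>auto simp: store_union_single_absorb\<close>)
      then show "S' = ?S \<and> ?conv M'"
        using vs(2) by (simp add: den_ty_Val_iff converges_Val)
    next
      assume irred: "\<And>M' S'. \<not> red (Get (Val (Loc r))) ?S M' S'"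
      \<comment> \<open>The set of readable values is nonempty, so the read can proceed and the
        clause for irreducible terms is vacuous.\<close>
      have "default_val A \<in> vs"
        using vs(2) den_ty_default_val[OF wf_ty_TReg(3)[OF wf] R''R] by blast
      then have "store_union (single r (default_val A)) ?S = ?S"
        using vs(1) by (simp add: store_union_single_absorb)
      from red_plug[OF head_get[OF this], of Hole] irred
      show "good_result R R'' A (Get (Val (Loc r)))" by simp
    qed
    have "?conv (plug (EGet Hole) M)"
      by (rule converges_plug[OF den_ty_converges[OF M R'']])
        (use loc in \<open>auto simp: good_result_simps\<close>)
    then show ?thesis by simp
  qed
  moreover have "typing R' [] (Get M) (A, e |\<union>| {|r|})"
    using M by (intro ty_get den_ty_typing)
  ultimately show ?thesis using R' unfolding den_ty_iff by blast
qed

lemma den_ty_Set: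
  assumes M: "(R', M) \<in> den_ty R (TReg r A) e1" and N: "(R', N) \<in> den_ty R A e2"
    and wf: "wf_ty R (TReg r A)"
  shows "(R', Set M N) \<in> den_ty R TUnit (e1 |\<union>| e2 |\<union>| {|r|})"
proof -
  have R': "rext R' R" using M by (simp add: den_ty_iff)
  have "converges (den_store R R'') (good_result R R'' TUnit) (Set M N)" if R'': "rext R'' R'" for R''
  proof -
    let ?S = "den_store R R''"
    let ?conv = "converges ?S (good_result R R'' TUnit)"
    have R''R: "rext R'' R" using R'' R' by (rule rext_trans)
    obtain vs where vs: "fmlookup ?S r = Some vs" "\<And>V. V \<in> vs \<longleftrightarrow> (R'', Val V) \<in> den_ty R A {||}"
      using wf R''R by (rule den_store_mem) blast
    have assign: "?conv (Set (Val (Loc r)) (Val W))" if "W \<in> vs" for W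
    proof (rule convergesI)
      have absorb: "store_union (single r W) ?S = ?S"
        using vs(1) that by (simp add: store_union_single_absorb)
      show "S' = ?S \<and> ?conv M'" if "red (Set (Val (Loc r)) (Val W)) ?S M' S'" for M' S'
        using red_Set_Val[OF that]
        by cases (simp_all add: absorb converges_Val good_result_simps)
      show "good_result R R'' TUnit (Set (Val (Loc r)) (Val W))"
        if "\<And>M' S'. \<not> red (Set (Val (Loc r)) (Val W)) ?S M' S'"
        using that red_plug[OF head_set[of r W ?S], of Hole] by simp
    qed
    have "?conv (plug (ESetL Hole N) M)"
    proof (rule converges_plug[OF den_ty_converges[OF M R'']])
      fix V
      assume V: "good_result R R'' (TReg r A) (Val V)"
      have "?conv (plug (ESetR (Loc r) Hole) N)"
      proof (rule converges_plug[OF den_ty_typed_converges[OF N R'']])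
        fix W
        assume "good_result R R'' A (Val W) \<and> typing R'' [] (Val W) (A, e2)"
        then have "(R'', Val W) \<in> den_ty R A {||}"
          using typing_Val_pure R''R by (auto simp: den_ty_Val_iff)
        then show "?conv (plug (ESetR (Loc r) Hole) (Val W))"
          using assign vs(2) by simp
      qed (use good_result_Val in blast)
      then show "?conv (plug (ESetL Hole N) (Val V))" using V by (simp add: good_result_simps)
    qed (rule good_result_Val)
    then show ?thesis by simp
  qed
  moreover have "typing R' [] (Set M N) (TUnit, e1 |\<union>| e2 |\<union>| {|r|})"
    using M N by (intro ty_set den_ty_typing)
  ultimately show ?thesis using R' unfolding den_ty_iff by blast
qed

lemma sem_typingI:
  assumes "\<And>R' Vs. rext R' R \<Longrightarrow> length Vs = length \<Gamma> \<Longrightarrow>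
    (\<And>i. i < length \<Gamma> \<Longrightarrow> (R', Val (Vs ! i)) \<in> den_ty R (\<Gamma> ! i) {||}) \<Longrightarrow>
    (R', msubst Vs M) \<in> den_ty R A e"
  shows "sem_typing R \<Gamma> M (A, e)"
  using assms by (simp add: sem_typing_def)

lemma sem_typingD:
  assumes "sem_typing R \<Gamma> M (A, e)" "rext R' R" "length Vs = length \<Gamma>"
    "\<And>i. i < length \<Gamma> \<Longrightarrow> (R', Val (Vs ! i)) \<in> den_ty R (\<Gamma> ! i) {||}"
  shows "(R', msubst Vs M) \<in> den_ty R A e"
  using assms by (simp add: sem_typing_def)

text \<open>The function may be called at any later \<open>R1\<close>, to which \<open>Vs\<close> is
  moved by monotonicity; there the instantiated body is good, and head expansion gives the call.
  Typing of the body is assumed separately because clause (1) asks for a type of the abstraction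
  itself.\<close>

lemma sem_typing_Lam:
  assumes typed: "typing R (A # \<Gamma>) M (B, e)" and sem: "sem_typing R (A # \<Gamma>) M (B, e)"
  shows "sem_typing R \<Gamma> (Val (Lam M)) (TFun A e B, {||})"
proof (rule sem_typingI)
  fix R' Vs
  assume R': "rext R' R" and len: "length Vs = length \<Gamma>"
    and Vs: "\<And>i. i < length \<Gamma> \<Longrightarrow> (R', Val (Vs ! i)) \<in> den_ty R (\<Gamma> ! i) {||}"
  define M0 where "M0 = subst M (lift_sub (value_sub Vs))"
  have M0: "msubst Vs (Val (Lam M)) = Val (Lam M0)" by (simp add: msubst_eq M0_def)
  have typ0: "typing R' [] (Val (Lam M0)) (TFun A e B, {||})"
    using typing_msubst[OF typing_rext[OF ty_lam[OF typed] R'] rext_wf(1)[OF R'] len] Vs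
    by (simp add: M0 den_ty_iff)
  have "(R1, App (Val (Lam M0)) (Val V)) \<in> den_ty R B e"
    if R1: "rext R1 R'" and V: "(R1, Val V) \<in> den_ty R A {||}" for R1 V
  proof (rule den_ty_beta)
    have "(R1, Val ((V # Vs) ! i)) \<in> den_ty R ((A # \<Gamma>) ! i) {||}" if "i < length (A # \<Gamma>)" for i
      using that V den_ty_rext[OF Vs R1] by (cases i) auto
    then show "(R1, msubst [V] M0) \<in> den_ty R B e"
      unfolding M0_def msubst_Cons
      using sem_typingD[OF sem rext_trans[OF R1 R'], of "V # Vs"] len by simp
    have "typing R1 [] (Val V) (A, {||})" using V by (simp add: den_ty_iff)
    from ty_app[OF typing_rext[OF typ0 R1] this]
    show "typing R1 [] (App (Val (Lam M0)) (Val V)) (B, e)" by simp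
  qed
  with R' typ0 show "(R', msubst Vs (Val (Lam M))) \<in> den_ty R (TFun A e B) {||}"
    unfolding M0 by (simp add: den_ty_Val_iff good_result_simps)
qed

theorem theorem1:
  fixes R :: rctx and \<Gamma> :: ctx and M :: trm and B :: ty and e :: eff
  assumes "typing R \<Gamma> M (B, e)"
  shows "sem_typing R \<Gamma> M (B, e)"
  using assms
proof (induction \<Gamma> M "(B, e)" arbitrary: B e rule: typing.induct)
  case (ty_var \<Gamma> i A)
  then show ?case by (intro sem_typingI) (auto simp: msubst_eq value_sub_def)
next
  case (ty_loc \<Gamma> r A)
  show ?case
  proof (rule sem_typingI)
    fix R' Vs
    assume R': "rext R' R"
    have "typing R' [] (Val (Loc r)) (TReg r A, {||})"
      using ty_loc rext_set[OF R'] rext_wf(1)[OF R'] by (auto simp: wf_ctx_def intro: typing.ty_loc)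
    with R' show "(R', msubst Vs (Val (Loc r))) \<in> den_ty R (TReg r A) {||}"
      by (simp add: msubst_eq den_ty_Val_iff good_result_simps)
  qed
next
  case (ty_star \<Gamma>)
  show ?case
  proof (rule sem_typingI)
    fix R' Vs
    assume R': "rext R' R"
    have "typing R' [] (Val Star) (TUnit, {||})"
      using rext_wf(1)[OF R'] by (simp add: wf_ctx_def typing.ty_star)
    with R' show "(R', msubst Vs (Val Star)) \<in> den_ty R TUnit {||}"
      by (simp add: msubst_eq den_ty_Val_iff good_result_simps)
  qed
next
  case (ty_lam A \<Gamma> M B e)
  then show ?case by (rule sem_typing_Lam)
next
  case (ty_app \<Gamma> M A e2 B e1 N e3)
  show ?case
  proof (rule sem_typingI)
    fix R' Vs
    assume *: "rext R' R" "length Vs = length \<Gamma>"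
      "\<And>i. i < length \<Gamma> \<Longrightarrow> (R', Val (Vs ! i)) \<in> den_ty R (\<Gamma> ! i) {||}"
    show "(R', msubst Vs (App M N)) \<in> den_ty R B (e1 |\<union>| e2 |\<union>| e3)"
      using den_ty_App[OF sem_typingD[OF ty_app(2) *] sem_typingD[OF ty_app(4) *]]
      by (simp add: msubst_eq)
  qed
next
  case (ty_get \<Gamma> M r A e)
  \<comment> \<open>Well-formedness locates \<open>r\<close> in \<open>R\<close>, which is what
    makes its entry in the store accessible.\<close>
  have wf: "wf_ty R (TReg r A)" using typing_wf[OF ty_get(1)] by simp
  show ?case
  proof (rule sem_typingI)
    fix R' Vs
    assume *: "rext R' R" "length Vs = length \<Gamma>"
      "\<And>i. i < length \<Gamma> \<Longrightarrow> (R', Val (Vs ! i)) \<in> den_ty R (\<Gamma> ! i) {||}"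
    show "(R', msubst Vs (Get M)) \<in> den_ty R A (e |\<union>| {|r|})"
      using den_ty_Get[OF sem_typingD[OF ty_get(2) *] wf] by (simp add: msubst_eq)
  qed
next
  case (ty_set \<Gamma> M r A e1 N e2)
  have wf: "wf_ty R (TReg r A)" using typing_wf[OF ty_set(1)] by simp
  show ?case
  proof (rule sem_typingI)
    fix R' Vs
    assume *: "rext R' R" "length Vs = length \<Gamma>"
      "\<And>i. i < length \<Gamma> \<Longrightarrow> (R', Val (Vs ! i)) \<in> den_ty R (\<Gamma> ! i) {||}"
    show "(R', msubst Vs (Set M N)) \<in> den_ty R TUnit (e1 |\<union>| e2 |\<union>| {|r|})"
      using den_ty_Set[OF sem_typingD[OF ty_set(2) *] sem_typingD[OF ty_set(4) *] wf]
      by (simp add: msubst_eq)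
  qed
next
  case (ty_sub \<Gamma> M A e A' e')
  then have le: "subty R A A'" "e |\<subseteq>| e'" "e' |\<subseteq>| rdom R" by (simp_all add: subty_eff_def)
  show ?case
    by (rule sem_typingI) (rule den_ty_subty[OF le sem_typingD[OF ty_sub(2)]])
qed

end
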